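(* For any integer $q\ge2$, $\mathrm{QACC}=\mathrm{QACC}[q]$; that is, every operator family in $\mathrm{QACC}$ is $\mathrm{QAC}^0$-reducible to (i.e. can be simulated up to work bits by) a family in $\mathrm{QACC}[q]$, and conversely.
   Context: Gates: one-qubit gates are elements of $U(2)$; for $U\in U(2)$, $\wedge_m(U)$ applies $U$ to the last qubit iff the first $m$ qubits are all $1$; a Toffoli gate is $\wedge_m(X)$, $X=\begin{pmatrix}0&1\\1&0\end{pmatrix}$, $m\ge0$; a controlled-not is $\wedge_1(X)$; a controlled-not layer performs, in one step, controlled-nots between an arbitrary collection of disjoint pairs of lines. For Boolean $y$, $\mathrm{Mod}_q(y_1,\ldots,y_m)=1$ iff $\sum y_i\not\equiv0\pmod q$, and the quantum $\mathrm{MOD}_q$ gate maps $|y_1,\ldots,y_m,x\rangle\mapsto|y_1,\ldots,y_m,x\oplus\mathrm{Mod}_q(y)\rangle$. $\mathrm{QAC}^0$ is the class of families $\{F_n\}$, $F_n\in U(2^{n+p(n)})$ ($p$ a polynomial), each $F_n$ a product of $O(1)$ layers, each layer either a Kronecker product of one-qubit and Toffoli gates or a controlled-not layer, with the number of distinct one-qubit gate types fixed independently of $n$. $\mathrm{QACC}[q]$ is defined the same way but layers may also contain (unbounded fan-in) $\mathrm{MOD}_q$ gates, and $\mathrm{QACC}=\bigcup_q\mathrm{QACC}[q]$. $\{F_n\}$ is $\mathrm{QAC}^0$-reducible to $\{G_n\}$ if there is a family $\{R_n\}$ of $\mathrm{QAC}^0$ operators augmented with operators from $\{G_n\}$ such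 that for all $n$, ${\bf x},{\bf y}\in\{0,1\}^n$ some work-bit setting ${\bf z}\in\{0,1\}^{p(n)}$ gives $\langle{\bf y}|F_n|{\bf x}\rangle=\langle{\bf y},{\bf z}|R_n|{\bf x},{\bf z}\rangle$. Equality of operator classes is understood up to this mutual reducibility. *)

theory Defs
  imports Complex_Main
begin

text \<open>A computational basis state of N qubits (lines 0..N-1) is a bool list of length N.
  An operator on N qubits is given by its matrix entries: op y x = <y|op|x>
  (only entries with length x = length y = N are meaningful).\<close>

type_synonym bstate = "bool list"
type_synonym qop = "bstate \<Rightarrow> bstate \<Rightarrow> complex"
type_synonym qfam = "nat \<Rightarrow> qop"

definition states :: "nat \<Rightarrow> bstate set" where
  "states N = {s. length s = N}"

definition op_id :: qop where
  "op_id y x = (if y = x then 1 else 0)"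

definition op_mult :: "nat \<Rightarrow> qop \<Rightarrow> qop \<Rightarrow> qop" where
  "op_mult N A B y x = (\<Sum>z\<in>states N. A y z * B z x)"

type_synonym mat2 = "bool \<Rightarrow> bool \<Rightarrow> complex"

definition unitary2 :: "mat2 \<Rightarrow> bool" where
  "unitary2 U \<longleftrightarrow> (\<forall>i j. (\<Sum>k\<in>UNIV. cnj (U k i) * U k j) = (if i = j then 1 else 0))"

definition Modq :: "nat \<Rightarrow> bool list \<Rightarrow> bool" where
  "Modq q ys \<longleftrightarrow> length (filter id ys) mod q \<noteq> 0"

datatype gate =
    OneQ mat2 nat
  | Toff "nat list" nat           \<comment> \<open>Toffoli gate wedge_m(X): controls, target (m \<ge> 0)\<close>
  | ModG nat "nat list" nat       \<comment> \<open>MOD_q gate: modulus q, inputs y_1..y_m, target x\<close>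
  | Orc nat "nat list"            \<comment> \<open>oracle gate G_m from a given family, on the given lines\<close>

fun glines :: "gate \<Rightarrow> nat list" where
  "glines (OneQ U i) = [i]"
| "glines (Toff cs t) = cs @ [t]"
| "glines (ModG q ys t) = ys @ [t]"
| "glines (Orc m ls) = ls"

definition perm_mat :: "(bool list \<Rightarrow> bool list) \<Rightarrow> qop" where
  "perm_mat f out inp = (if out = f inp then 1 else 0)"

definition toff_fun :: "bool list \<Rightarrow> bool list" where
  "toff_fun b = butlast b @ [last b \<noteq> (\<forall>c\<in>set (butlast b). c)]"

definition mod_fun :: "nat \<Rightarrow> bool list \<Rightarrow> bool list" where
  "mod_fun q b = butlast b @ [last b \<noteq> Modq q (butlast b)]"

text \<open>Local matrix of a gate on the bits of its own lines (in the order of glines);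
  oracle gates take their matrix from the oracle family G.\<close>
fun gmat :: "qfam \<Rightarrow> gate \<Rightarrow> qop" where
  "gmat G (OneQ U i) out inp = U (hd out) (hd inp)"
| "gmat G (Toff cs t) out inp = perm_mat toff_fun out inp"
| "gmat G (ModG q ys t) out inp = perm_mat (mod_fun q) out inp"
| "gmat G (Orc m ls) out inp = G m out inp"

text \<open>Well-formedness of a gate in a circuit of width N, where wG m is the number of
  qubits the oracle operator G_m acts on.\<close>
definition gate_wf :: "(nat \<Rightarrow> nat) \<Rightarrow> nat \<Rightarrow> gate \<Rightarrow> bool" where
  "gate_wf wG N g \<longleftrightarrow> distinct (glines g) \<and> (\<forall>i\<in>set (glines g). i < N)
     \<and> (case g of OneQ U i \<Rightarrow> unitary2 U | Orc m ls \<Rightarrow> length ls = wG m | _ \<Rightarrow> True)"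

datatype layer =
    GLayer "gate list"              \<comment> \<open>tensor (Kronecker) product of gates on disjoint lines\<close>
  | CnotLayer "(nat \<times> nat) list"    \<comment> \<open>controlled-nots on disjoint pairs (control, target)\<close>

fun layer_gates :: "layer \<Rightarrow> gate list" where
  "layer_gates (GLayer gs) = gs"
| "layer_gates (CnotLayer ps) = map (\<lambda>(c, t). Toff [c] t) ps"

definition layer_wf :: "(nat \<Rightarrow> nat) \<Rightarrow> nat \<Rightarrow> layer \<Rightarrow> bool" where
  "layer_wf wG N L \<longleftrightarrow> (let gs = layer_gates L in
     (\<forall>g\<in>set gs. gate_wf wG N g) \<and>
     (\<forall>i<length gs. \<forall>j<length gs. i \<noteq> j \<longrightarrow> set (glines (gs!i)) \<inter> set (glines (gs!j)) = {}))"

definition layer_mat :: "qfam \<Rightarrow> nat \<Rightarrow> layer \<Rightarrow> qop" where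
  "layer_mat G N L y x =
     (let gs = layer_gates L in
      (\<Prod>g\<leftarrow>gs. gmat G g (map ((!) y) (glines g)) (map ((!) x) (glines g))) *
      (if \<forall>i<N. (\<forall>g\<in>set gs. i \<notin> set (glines g)) \<longrightarrow> y!i = x!i then 1 else 0))"

fun circ_mat :: "qfam \<Rightarrow> nat \<Rightarrow> layer list \<Rightarrow> qop" where
  "circ_mat G N [] = op_id"
| "circ_mat G N (L # Ls) = op_mult N (circ_mat G N Ls) (layer_mat G N L)"

definition poly_bounded :: "(nat \<Rightarrow> nat) \<Rightarrow> bool" where
  "poly_bounded a \<longleftrightarrow> (\<exists>c k. \<forall>n. a n \<le> c * n ^ k + c)"

definition circ_ok :: "(gate \<Rightarrow> bool) \<Rightarrow> (nat \<Rightarrow> nat) \<Rightarrow> nat \<Rightarrow> nat \<Rightarrow> mat2 set \<Rightarrow> layer list \<Rightarrow> bool" where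
  "circ_ok ok wG N d S C \<longleftrightarrow> length C \<le> d \<and>
     (\<forall>L\<in>set C. layer_wf wG N L \<and>
        (\<forall>g\<in>set (layer_gates L). ok g \<and> (\<forall>U i. g = OneQ U i \<longrightarrow> U \<in> S)))"

definition qac0_gate :: "gate \<Rightarrow> bool" where
  "qac0_gate g \<longleftrightarrow> (case g of OneQ U i \<Rightarrow> True | Toff cs t \<Rightarrow> True | _ \<Rightarrow> False)"

definition qaccq_gate :: "nat \<Rightarrow> gate \<Rightarrow> bool" where
  "qaccq_gate q g \<longleftrightarrow> qac0_gate g \<or> (\<exists>ys t. g = ModG q ys t)"

definition circ_class :: "(gate \<Rightarrow> bool) \<Rightarrow> (nat \<Rightarrow> nat) \<Rightarrow> qfam \<Rightarrow> bool" where
  "circ_class ok w F \<longleftrightarrow> (\<exists>p d S. poly_bounded p \<and> finite S \<and>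
     (\<forall>n. w n = n + p n \<and>
        (\<exists>C. circ_ok ok (\<lambda>_. 0) (w n) d S C \<and>
             (\<forall>x\<in>states (w n). \<forall>y\<in>states (w n). F n y x = circ_mat (\<lambda>_ _ _. 0) (w n) C y x))))"

definition QAC0 :: "(nat \<Rightarrow> nat) \<Rightarrow> qfam \<Rightarrow> bool" where
  "QAC0 w F \<longleftrightarrow> circ_class qac0_gate w F"

definition QACCq :: "nat \<Rightarrow> (nat \<Rightarrow> nat) \<Rightarrow> qfam \<Rightarrow> bool" where
  "QACCq q w F \<longleftrightarrow> circ_class (qaccq_gate q) w F"

definition QACC :: "(nat \<Rightarrow> nat) \<Rightarrow> qfam \<Rightarrow> bool" where
  "QACC w F \<longleftrightarrow> (\<exists>q\<ge>2. QACCq q w F)"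

text \<open>QAC0-reducibility of (wF,F) to (wG,G): a family of constant-depth circuits with QAC0
  gates and oracle gates G_m (any m), finitely many one-qubit gate types, on wF n + k n
  qubits (k polynomially bounded work bits, placed after F's lines), such that for all
  basis states x, y of F_n some work-bit setting z gives <y|F_n|x> = <y,z|R_n|x,z>.\<close>
definition qac0_reducible :: "(nat \<Rightarrow> nat) \<Rightarrow> qfam \<Rightarrow> (nat \<Rightarrow> nat) \<Rightarrow> qfam \<Rightarrow> bool" where
  "qac0_reducible wF F wG G \<longleftrightarrow> (\<exists>k d S. poly_bounded k \<and> finite S \<and>
     (\<forall>n. \<exists>C. circ_ok (\<lambda>g. qac0_gate g \<or> (\<exists>m ls. g = Orc m ls)) wG (wF n + k n) d S C \<and>
          (\<forall>x\<in>states (wF n). \<forall>y\<in>states (wF n). \<exists>z\<in>states (k n).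
              F n y x = circ_mat G (wF n + k n) C (y @ z) (x @ z))))"

end

(*
It suffices to compute MOD_p by MOD_q gates in constant depth, for p, q >= 2.

A register of r - 1 lines can be rotated by one-qubit gates so that its number of leading ones
(its digit) is uniform on {0..r-1}. If every unit of the digit then contributes a phase alpha with
alpha^r = 1 and the rotation is undone, the amplitude at the zero state is the mean of
1, alpha, ..., alpha^(r-1). Hence afterwards the register is zero with certainty if alpha = 1 and
nonzero with certainty otherwise.

With r = q this copies a line c: rotate m registers, compute the sum of their digits modulo q by
MOD_q gates, apply the phase w_q^(c * sum) with w_q a primitive q-th root of unity, uncompute and
rotate back. The phase is a product over the registers, so each of them is now nonzero exactly when
c = 1.

With r = p it computes MOD_p of m lines x_1, ..., x_m: the phase w_p^(digit * sum x_i) is a product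
of the phases w_p^(u * x_i) over the bits u of the unary representation of the digit, and these can
be applied in parallel to copies of u. The register is now nonzero exactly when MOD_p(x) = 1; flip
the target accordingly and undo everything.
*)

theory Submission
  imports Defs "HOL-Library.Countable"
begin

section \<open>Operators on state vectors\<close>

text \<open>State vectors live on assignments of all lines \<open>0, 1, 2, \<dots>\<close>, so that operators need no width.\<close>

type_synonym assignment = "nat \<Rightarrow> bool"
type_synonym vec = "assignment \<Rightarrow> complex"

definition eq_off :: "nat set \<Rightarrow> assignment \<Rightarrow> assignment \<Rightarrow> bool" where
  "eq_off W y x \<longleftrightarrow> (\<forall>i. i \<notin> W \<longrightarrow> y i = x i)"

definition ignores :: "nat set \<Rightarrow> (assignment \<Rightarrow> 'a) \<Rightarrow> bool" where
  "ignores W f \<longleftrightarrow> (\<forall>y x. eq_off W y x \<longrightarrow> f y = f x)"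

definition zero_on :: "nat set \<Rightarrow> assignment \<Rightarrow> bool" where
  "zero_on W y \<longleftrightarrow> (\<forall>l\<in>W. \<not> y l)"

definition diag :: "vec \<Rightarrow> vec \<Rightarrow> vec" where
  "diag d \<psi> y = d y * \<psi> y"

definition supported :: "(assignment \<Rightarrow> bool) \<Rightarrow> vec \<Rightarrow> bool" where
  "supported P \<psi> \<longleftrightarrow> (\<forall>y. \<psi> y \<noteq> 0 \<longrightarrow> P y)"

definition hoare :: "(assignment \<Rightarrow> bool) \<Rightarrow> (vec \<Rightarrow> vec) \<Rightarrow> (assignment \<Rightarrow> bool) \<Rightarrow> bool" where
  "hoare P A Q \<longleftrightarrow> (\<forall>\<psi>. supported P \<psi> \<longrightarrow> supported Q (A \<psi>))"

lemma ignoresI: "(\<And>y x. (\<And>i. i \<notin> W \<Longrightarrow> y i = x i) \<Longrightarrow> f y = f x) \<Longrightarrow> ignores W f"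
  unfolding ignores_def eq_off_def by blast

lemma ignores_fun_upd: "ignores W f \<Longrightarrow> i \<in> W \<Longrightarrow> f (y(i := b)) = f y"
  unfolding ignores_def eq_off_def by (metis fun_upd_other)

lemma ignores_subset: "ignores W f \<Longrightarrow> V \<subseteq> W \<Longrightarrow> ignores V f"
  unfolding ignores_def eq_off_def by blast

lemma ignores_compose: "ignores W f \<Longrightarrow> ignores W (\<lambda>y. h (f y))"
  unfolding ignores_def by metis

lemma ignores_compose2: "ignores W f \<Longrightarrow> ignores W g \<Longrightarrow> ignores W (\<lambda>y. h (f y) (g y))"
  unfolding ignores_def by metis

lemma ignores_line: "l \<notin> W \<Longrightarrow> ignores W (\<lambda>y. y l)"
  by (simp add: ignores_def eq_off_def)

lemma ignores_ball: "(\<And>i. i \<in> I \<Longrightarrow> ignores W (P i)) \<Longrightarrow> ignores W (\<lambda>y. \<forall>i\<in>I. P i y)"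
  unfolding ignores_def by metis

lemma ignores_zero_on: "V \<inter> W = {} \<Longrightarrow> ignores W (zero_on V)"
  unfolding ignores_def eq_off_def zero_on_def by blast

lemma zero_on_subset: "zero_on W y \<Longrightarrow> V \<subseteq> W \<Longrightarrow> zero_on V y"
  by (auto simp: zero_on_def)

lemma diag_comp: "diag d (diag e \<psi>) = diag (\<lambda>y. d y * e y) \<psi>"
  by (simp add: diag_def fun_eq_iff)

lemma diag_cong_supported: "supported P \<psi> \<Longrightarrow> (\<And>y. P y \<Longrightarrow> d y = e y) \<Longrightarrow> diag d \<psi> = diag e \<psi>"
  by (auto simp: diag_def supported_def fun_eq_iff)

lemma supported_iff_diag: "supported P \<psi> \<longleftrightarrow> diag (\<lambda>y. of_bool (P y)) \<psi> = \<psi>"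
  by (auto simp: supported_def diag_def fun_eq_iff)

lemma supported_mono: "supported P \<psi> \<Longrightarrow> (\<And>y. P y \<Longrightarrow> Q y) \<Longrightarrow> supported Q \<psi>"
  by (auto simp: supported_def)

lemma fold_diag: "fold (\<lambda>i. diag (f i)) is = diag (\<lambda>y. \<Prod>i\<leftarrow>is. f i y)"
  by (induction "is") (auto simp: diag_def fun_eq_iff mult_ac)

lemma hoare_mono:
  "hoare P A Q \<Longrightarrow> (\<And>y. P' y \<Longrightarrow> P y) \<Longrightarrow> (\<And>y. Q y \<Longrightarrow> Q' y) \<Longrightarrow> hoare P' A Q'"
  by (auto simp: hoare_def supported_def)

lemma hoare_comp: "hoare P A Q \<Longrightarrow> hoare Q B R \<Longrightarrow> hoare P (B \<circ> A) R"
  by (simp add: hoare_def)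

lemma hoare_conj: "hoare P A Q \<Longrightarrow> hoare P' A Q' \<Longrightarrow> hoare (\<lambda>y. P y \<and> P' y) A (\<lambda>y. Q y \<and> Q' y)"
  by (auto simp: hoare_def supported_def)

lemma hoare_all:
  assumes "\<And>i. i \<in> I \<Longrightarrow> hoare (P i) A (Q i)"
  shows "hoare (\<lambda>y. \<forall>i\<in>I. P i y) A (\<lambda>y. \<forall>i\<in>I. Q i y)"
  using assms unfolding hoare_def supported_def by blast

lemma hoare_diag: "hoare P (diag d) P"
  by (auto simp: hoare_def supported_def diag_def)

lemma hoare_fold_invariant:
  "(\<And>i. i \<in> set is \<Longrightarrow> hoare P (A i) P) \<Longrightarrow> hoare P (fold A is) P"
proof (induction "is")
  case (Cons i "is")
  then show ?case by (simp add: hoare_def)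
qed (simp add: hoare_def)

lemma hoare_fold:
  assumes "distinct is" "\<And>i. i \<in> set is \<Longrightarrow> hoare (P i) (A i) (Q i)"
    and frame: "\<And>i j. i \<in> set is \<Longrightarrow> j \<in> set is \<Longrightarrow> i \<noteq> j \<Longrightarrow>
      hoare (P j) (A i) (P j) \<and> hoare (Q j) (A i) (Q j)"
  shows "hoare (\<lambda>y. \<forall>i\<in>set is. P i y) (fold A is) (\<lambda>y. \<forall>i\<in>set is. Q i y)"
  using assms
proof (induction "is")
  case Nil
  show ?case by (simp add: hoare_def)
next
  case (Cons i "is")
  have "hoare (\<lambda>y. P i y \<and> (\<forall>j\<in>set is. P j y)) (A i) (\<lambda>y. Q i y \<and> (\<forall>j\<in>set is. P j y))"
  proof (intro hoare_conj hoare_all)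
    show "hoare (P i) (A i) (Q i)" using Cons.prems(2)[of i] by simp
    show "hoare (P j) (A i) (P j)" if "j \<in> set is" for j using Cons.prems(1,3) that by auto
  qed
  moreover have "hoare (\<lambda>y. Q i y \<and> (\<forall>j\<in>set is. P j y)) (fold A is)
      (\<lambda>y. Q i y \<and> (\<forall>j\<in>set is. Q j y))"
  proof (intro hoare_conj hoare_fold_invariant)
    show "hoare (Q i) (A j) (Q i)" if "j \<in> set is" for j using Cons.prems(1,3) that by auto
    show "hoare (\<lambda>y. \<forall>j\<in>set is. P j y) (fold A is) (\<lambda>y. \<forall>j\<in>set is. Q j y)"
      by (rule Cons.IH) (use Cons.prems in auto)
  qed
  ultimately show ?case by (simp add: hoare_def)
qed

lemma fold_cong_supported:
  assumes "\<And>i \<psi>. i \<in> set is \<Longrightarrow> supported P \<psi> \<Longrightarrow> A i \<psi> = B i \<psi>"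
    and "\<And>i. i \<in> set is \<Longrightarrow> hoare P (B i) P" "supported P \<psi>"
  shows "fold A is \<psi> = fold B is \<psi>"
  using assms
  by (induction "is" arbitrary: \<psi>) (auto simp: hoare_def)

section \<open>Gates\<close>

text \<open>Every gate changes one line only, by a \<open>2 \<times> 2\<close> matrix that may depend on its other lines.
  Oracle gates are given the identity as a junk value.\<close>

fun target :: "gate \<Rightarrow> nat" where
  "target (OneQ U i) = i"
| "target (Toff cs t) = t"
| "target (ModG q ys t) = t"
| "target (Orc m ls) = 0"

fun toggles :: "gate \<Rightarrow> assignment \<Rightarrow> bool" where
  "toggles (OneQ U i) y = False"
| "toggles (Toff cs t) y = (\<forall>c\<in>set cs. y c)"
| "toggles (ModG q ys t) y = Modq q (map y ys)"
| "toggles (Orc m ls) y = False"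

definition classical :: "gate \<Rightarrow> bool" where
  "classical g \<longleftrightarrow> (\<forall>U i. g \<noteq> OneQ U i)"

fun target_entry :: "gate \<Rightarrow> assignment \<Rightarrow> bool \<Rightarrow> complex" where
  "target_entry (OneQ U i) y b = U (y i) b"
| "target_entry g y b = of_bool (b = (y (target g) \<noteq> toggles g y))"

definition apply_gate :: "gate \<Rightarrow> vec \<Rightarrow> vec" where
  "apply_gate g \<psi> y = (\<Sum>b\<in>UNIV. target_entry g y b * \<psi> (y(target g := b)))"

abbreviation apply_gates :: "gate list \<Rightarrow> vec \<Rightarrow> vec" where
  "apply_gates \<equiv> fold apply_gate"

lemma toggles_fun_upd:
  assumes "i \<notin> set (glines g)"
  shows "toggles g (y(i := b)) = toggles g y"
proof (cases g)
  case (ModG q ys t)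
  then show ?thesis using assms by (simp del: fun_upd_apply)
qed (use assms in auto)

lemma toggles_target_upd:
  assumes "distinct (glines g)"
  shows "toggles g (y(target g := b)) = toggles g y"
proof (cases g)
  case (ModG q ys t)
  then show ?thesis using assms by (simp del: fun_upd_apply)
qed (use assms in auto)

lemma classical_simps [simp]: "classical (Toff cs t)" "classical (ModG q ys t)"
  by (simp_all add: classical_def)

lemma target_entry_classical:
  "classical g \<Longrightarrow> target_entry g y b = of_bool (b = (y (target g) \<noteq> toggles g y))"
  by (cases g) (auto simp: classical_def)

lemma target_entry_fun_upd:
  assumes "i \<notin> set (glines g)" "i \<noteq> target g"
  shows "target_entry g (y(i := b)) = target_entry g y"
proof (cases "classical g")
  case True
  then show ?thesis
    using assms by (simp add: target_entry_classical toggles_fun_upd fun_eq_iff)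
next
  case False
  then show ?thesis using assms by (auto simp: classical_def fun_eq_iff)
qed

lemma apply_gate_commute:
  assumes "target g \<notin> set (glines h)" "target h \<notin> set (glines g)" "target g \<noteq> target h"
  shows "apply_gate g \<circ> apply_gate h = apply_gate h \<circ> apply_gate g"
  using assms by (simp add: fun_eq_iff apply_gate_def target_entry_fun_upd UNIV_bool
      fun_upd_twist[OF assms(3)] algebra_simps del: fun_upd_apply)

lemma apply_gates_commute:
  assumes "\<And>g h. g \<in> set gs \<Longrightarrow> h \<in> set hs \<Longrightarrow>
    target g \<notin> set (glines h) \<and> target h \<notin> set (glines g) \<and> target g \<noteq> target h"
  shows "apply_gates gs \<circ> apply_gates hs = apply_gates hs \<circ> apply_gates gs"
proof (rule fold_commute)
  fix h assume "h \<in> set hs"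
  then show "apply_gates gs \<circ> apply_gate h = apply_gate h \<circ> apply_gates gs"
    using assms by (intro fold_commute[symmetric] apply_gate_commute) (auto dest: not_sym)
qed

lemma apply_gates_diag:
  assumes "ignores W d" "\<And>g. g \<in> set gs \<Longrightarrow> target g \<in> W"
  shows "apply_gates gs (diag d \<psi>) = diag d (apply_gates gs \<psi>)"
proof -
  have "diag d \<circ> apply_gates gs = apply_gates gs \<circ> diag d"
  proof (rule fold_commute)
    fix g assume "g \<in> set gs"
    then have "d (y(target g := b)) = d y" for y b
      using assms by (intro ignores_fun_upd) auto
    then show "diag d \<circ> apply_gate g = apply_gate g \<circ> diag d"
      by (simp add: fun_eq_iff apply_gate_def diag_def sum_distrib_left mult.left_commute)
  qed
  then show ?thesis by (simp add: fun_eq_iff)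
qed

lemma hoare_apply_gates:
  assumes "ignores W P" "\<And>g. g \<in> set gs \<Longrightarrow> target g \<in> W"
  shows "hoare P (apply_gates gs) P"
proof -
  have "ignores W (\<lambda>y. of_bool (P y) :: complex)" using assms(1) by (rule ignores_compose)
  from apply_gates_diag[OF this assms(2), symmetric] show ?thesis
    by (simp add: hoare_def supported_iff_diag)
qed

lemma apply_classical:
  "classical g \<Longrightarrow> apply_gate g \<psi> y = \<psi> (y(target g := (y (target g) \<noteq> toggles g y)))"
  by (simp add: apply_gate_def target_entry_classical)

lemma hoare_toggle:
  assumes A: "\<And>\<psi> y. A \<psi> y = \<psi> (y(t := (y t \<noteq> f y)))" and f: "\<And>y b. f (y(t := b)) = f y"
    and PQ: "\<And>y. P y \<Longrightarrow> Q (y(t := (y t \<noteq> f y)))"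
  shows "hoare P A Q"
  unfolding hoare_def supported_def
proof (intro allI impI)
  fix \<psi> y
  define x where "x = y(t := (y t \<noteq> f y))"
  assume "\<forall>y. \<psi> y \<noteq> 0 \<longrightarrow> P y" "A \<psi> y \<noteq> 0"
  then have "Q (x(t := (x t \<noteq> f x)))" by (intro PQ) (simp add: A x_def)
  moreover have "x(t := (x t \<noteq> f x)) = y" by (auto simp: x_def f fun_eq_iff)
  ultimately show "Q y" by simp
qed

lemma hoare_classical:
  assumes "classical g" "distinct (glines g)"
    and "\<And>y. P y \<Longrightarrow> Q (y(target g := (y (target g) \<noteq> toggles g y)))"
  shows "hoare P (apply_gate g) Q"
  using apply_classical[OF assms(1)] toggles_target_upd[OF assms(2)] assms(3) by (rule hoare_toggle)

section \<open>Matrix entries of circuits\<close>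

definition assign :: "bstate \<Rightarrow> assignment" where
  "assign x i \<longleftrightarrow> i < length x \<and> x ! i"

definition basis_vec :: "assignment \<Rightarrow> vec" where
  "basis_vec x y = of_bool (y = x)"

definition disjoint_gates :: "gate list \<Rightarrow> bool" where
  "disjoint_gates = sorted_wrt (\<lambda>g h. disjnt (set (glines g)) (set (glines h)))"

definition is_oracle :: "gate \<Rightarrow> bool" where
  "is_oracle g \<longleftrightarrow> (\<exists>m ls. g = Orc m ls)"

definition run_circuit :: "layer list \<Rightarrow> vec \<Rightarrow> vec" where
  "run_circuit = fold (\<lambda>L. apply_gates (layer_gates L))"

lemma finite_states: "finite (states N)"
  unfolding states_def using finite_lists_length_eq[of "UNIV :: bool set" N] by simp

lemma assign_inject: "x \<in> states N \<Longrightarrow> y \<in> states N \<Longrightarrow> assign x = assign y \<longleftrightarrow> x = y"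
  by (auto simp: assign_def states_def fun_eq_iff list_eq_iff_nth_eq)

lemma ex_assign_eq:
  assumes "zero_on {N..} y"
  shows "\<exists>x\<in>states N. assign x = y"
proof
  have "i < N" if "y i" for i
    using assms that by (meson atLeast_iff leI zero_on_def)
  then show "assign (map y [0..<N]) = y"
    by (auto simp: assign_def fun_eq_iff)
qed (simp add: states_def)

lemma zero_on_assign: "x \<in> states N \<Longrightarrow> zero_on {N..} (assign x)"
  by (simp add: states_def zero_on_def assign_def)

lemma supported_basis_vec: "P x \<Longrightarrow> supported P (basis_vec x)"
  by (simp add: supported_def basis_vec_def)

lemma target_in_glines: "\<not> is_oracle g \<Longrightarrow> target g \<in> set (glines g)"
  by (cases g) (auto simp: is_oracle_def)

lemma qaccq_gate_not_oracle: "qaccq_gate r g \<Longrightarrow> \<not> is_oracle g"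
  by (auto simp: qaccq_gate_def qac0_gate_def is_oracle_def split: gate.splits)

lemma gmat_eq_target_entry:
  assumes "\<not> is_oracle g" "distinct (glines g)"
  shows "gmat G g (map y (glines g)) (map x (glines g)) =
    target_entry g y (x (target g)) * of_bool (\<forall>i\<in>set (glines g) - {target g}. y i = x i)"
proof (cases g)
  case (Toff cs t)
  then have "set (glines g) - {t} = set cs" using assms(2) by auto
  then show ?thesis
    using Toff by (cases "\<forall>i\<in>set cs. y i = x i") (auto simp: perm_mat_def toff_fun_def)
next
  case (ModG r ys t)
  then have "map y ys = map x ys \<longleftrightarrow> (\<forall>i\<in>set (glines g) - {t}. y i = x i)" using assms(2) by auto
  then show ?thesis using ModG
    by (cases "map y ys = map x ys") (auto simp: perm_mat_def mod_fun_def simp del: map_eq_conv)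
qed (use assms in \<open>auto simp: is_oracle_def\<close>)

lemma apply_gate_eq_off:
  assumes "\<not> is_oracle g" "distinct (glines g)" "A \<inter> set (glines g) = {}"
  shows "apply_gate g (\<lambda>w. of_bool (eq_off A w x)) y =
    gmat G g (map y (glines g)) (map x (glines g)) * of_bool (eq_off (A \<union> set (glines g)) y x)"
proof -
  let ?t = "target g"
  have t: "?t \<in> set (glines g)" using target_in_glines[OF assms(1)] .
  then have "eq_off A (y(?t := b)) x \<longleftrightarrow> b = x ?t \<and> eq_off (insert ?t A) y x" for b
    using assms(3) by (auto simp: eq_off_def)
  then have "apply_gate g (\<lambda>w. of_bool (eq_off A w x)) y =
      target_entry g y (x ?t) * of_bool (eq_off (insert ?t A) y x)"
    by (cases "x ?t") (auto simp: apply_gate_def UNIV_bool)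
  also have "eq_off (insert ?t A) y x \<longleftrightarrow>
      (\<forall>i\<in>set (glines g) - {?t}. y i = x i) \<and> eq_off (A \<union> set (glines g)) y x"
    using assms(3) t by (auto simp: eq_off_def) metis+
  finally show ?thesis by (simp only: gmat_eq_target_entry[OF assms(1,2)] of_bool_conj mult.assoc)
qed

lemma apply_gates_basis_vec:
  assumes "disjoint_gates gs" "\<And>g. g \<in> set gs \<Longrightarrow> \<not> is_oracle g \<and> distinct (glines g)"
  shows "apply_gates gs (basis_vec x) y =
    (\<Prod>g\<leftarrow>gs. gmat G g (map y (glines g)) (map x (glines g))) *
      of_bool (eq_off (\<Union>g\<in>set gs. set (glines g)) y x)"
  using assms
proof (induction gs arbitrary: y rule: rev_induct)
  case Nil
  show ?case by (simp add: basis_vec_def eq_off_def fun_eq_iff)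
next
  case (snoc g gs)
  let ?A = "\<Union>g\<in>set gs. set (glines g)"
  let ?d = "\<lambda>y. \<Prod>g\<leftarrow>gs. gmat G g (map y (glines g)) (map x (glines g))"
  have gs: "disjoint_gates gs" and disj: "?A \<inter> set (glines g) = {}"
    and g: "\<not> is_oracle g" "distinct (glines g)"
    using snoc.prems by (auto simp: disjoint_gates_def sorted_wrt_append disjnt_def)
  have "ignores {target g} ?d"
  proof (rule ignoresI, intro arg_cong[where f = prod_list] map_cong refl)
    fix y y' :: assignment and h assume "\<And>i. i \<notin> {target g} \<Longrightarrow> y i = y' i" "h \<in> set gs"
    then have "map y (glines h) = map y' (glines h)"
      using target_in_glines[OF g(1)] disj
      by (intro map_cong refl) (metis UN_I disjoint_iff singletonD)
    then show "gmat G h (map y (glines h)) (map x (glines h)) =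
        gmat G h (map y' (glines h)) (map x (glines h))"
      by (rule arg_cong)
  qed
  then have diag: "apply_gate g (diag ?d \<psi>) = diag ?d (apply_gate g \<psi>)" for \<psi>
    using apply_gates_diag[of "{target g}" ?d "[g]" \<psi>] by simp
  have "apply_gates gs (basis_vec x) = diag ?d (\<lambda>w. of_bool (eq_off ?A w x))"
    using snoc.IH[OF gs] snoc.prems(2) by (auto simp: diag_def fun_eq_iff)
  then have "apply_gates (gs @ [g]) (basis_vec x) y =
      ?d y * (gmat G g (map y (glines g)) (map x (glines g)) *
        of_bool (eq_off (?A \<union> set (glines g)) y x))"
    using diag apply_gate_eq_off[OF g disj] by (simp add: diag_def)
  then show ?case by (simp add: Un_commute)
qed

lemma layer_wf_iff:
  "layer_wf w N L \<longleftrightarrow> disjoint_gates (layer_gates L) \<and> (\<forall>g\<in>set (layer_gates L). gate_wf w N g)"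
proof -
  have "(\<forall>i<length gs. \<forall>j<length gs. i \<noteq> j \<longrightarrow> set (glines (gs!i)) \<inter> set (glines (gs!j)) = {}) \<longleftrightarrow>
      disjoint_gates gs" (is "?pairwise \<longleftrightarrow> _") for gs
  proof
    assume ?pairwise
    then show "disjoint_gates gs"
      by (auto simp: disjoint_gates_def sorted_wrt_iff_nth_less disjnt_def)
  next
    assume "disjoint_gates gs"
    then have "set (glines (gs!i)) \<inter> set (glines (gs!j)) = {}" if "i < j" "j < length gs" for i j
      using that by (simp add: disjoint_gates_def sorted_wrt_iff_nth_less disjnt_def)
    then show ?pairwise by (metis Int_commute nat_neq_iff)
  qed
  then show ?thesis by (auto simp: layer_wf_def Let_def)
qed

lemma layer_mat_eq_amplitude:
  assumes "layer_wf (\<lambda>_. 0) N L" "\<And>g. g \<in> set (layer_gates L) \<Longrightarrow> \<not> is_oracle g"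
    and "x \<in> states N" "y \<in> states N"
  shows "layer_mat G N L y x = apply_gates (layer_gates L) (basis_vec (assign x)) (assign y)"
proof -
  have lines: "disjoint_gates (layer_gates L)"
    "\<And>g. g \<in> set (layer_gates L) \<Longrightarrow> distinct (glines g) \<and> (\<forall>i\<in>set (glines g). i < N)"
    using assms(1) by (auto simp: layer_wf_iff gate_wf_def)
  have map_assign: "map (assign z) (glines g) = map ((!) z) (glines g)"
    if "g \<in> set (layer_gates L)" "z \<in> states N" for g z
    using lines(2)[OF that(1)] that(2) by (auto simp: assign_def states_def)
  have eq_off_assign: "eq_off (\<Union>g\<in>set (layer_gates L). set (glines g)) (assign y) (assign x) \<longleftrightarrow>
      (\<forall>i<N. (\<forall>g\<in>set (layer_gates L). i \<notin> set (glines g)) \<longrightarrow> y ! i = x ! i)"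
    using assms(3,4) by (auto simp: eq_off_def assign_def states_def)
  have "apply_gates (layer_gates L) (basis_vec (assign x)) (assign y) =
      (\<Prod>g\<leftarrow>layer_gates L. gmat G g (map ((!) y) (glines g)) (map ((!) x) (glines g))) *
      of_bool (eq_off (\<Union>g\<in>set (layer_gates L). set (glines g)) (assign y) (assign x))"
    using assms lines map_assign
    by (subst apply_gates_basis_vec[where G = G]) (auto cong: map_cong)
  then show ?thesis by (simp only: layer_mat_def Let_def eq_off_assign of_bool_def)
qed

lemma apply_gate_sum:
  "apply_gate g (\<lambda>y. \<Sum>z\<in>Z. a z * \<phi> z y) = (\<lambda>y. \<Sum>z\<in>Z. a z * apply_gate g (\<phi> z) y)"
proof
  fix y
  have "apply_gate g (\<lambda>y. \<Sum>z\<in>Z. a z * \<phi> z y) y =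
      (\<Sum>b\<in>UNIV. \<Sum>z\<in>Z. a z * (target_entry g y b * \<phi> z (y(target g := b))))"
    by (simp add: apply_gate_def sum_distrib_left mult.left_commute)
  also have "\<dots> = (\<Sum>z\<in>Z. a z * apply_gate g (\<phi> z) y)"
    by (subst sum.swap) (simp add: apply_gate_def sum_distrib_left)
  finally show "apply_gate g (\<lambda>y. \<Sum>z\<in>Z. a z * \<phi> z y) y = (\<Sum>z\<in>Z. a z * apply_gate g (\<phi> z) y)" .
qed

lemma run_circuit_sum:
  "run_circuit C (\<lambda>y. \<Sum>z\<in>Z. a z * \<phi> z y) = (\<lambda>y. \<Sum>z\<in>Z. a z * run_circuit C (\<phi> z) y)"
proof -
  have "apply_gates gs (\<lambda>y. \<Sum>z\<in>Z. a z * \<phi> z y) = (\<lambda>y. \<Sum>z\<in>Z. a z * apply_gates gs (\<phi> z) y)" for gs \<phi>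
    by (induction gs arbitrary: \<phi>) (simp_all add: apply_gate_sum)
  then show ?thesis
    unfolding run_circuit_def by (induction C arbitrary: \<phi>) simp_all
qed

lemma sum_basis_vec:
  assumes "supported (zero_on {N..}) \<psi>"
  shows "\<psi> = (\<lambda>y. \<Sum>z\<in>states N. \<psi> (assign z) * basis_vec (assign z) y)"
proof
  fix y
  show "\<psi> y = (\<Sum>z\<in>states N. \<psi> (assign z) * basis_vec (assign z) y)"
  proof (cases "zero_on {N..} y")
    case True
    then obtain x where x: "x \<in> states N" "assign x = y" using ex_assign_eq by blast
    then have "(\<Sum>z\<in>states N. \<psi> (assign z) * basis_vec (assign z) y) =
        (\<Sum>z\<in>states N. if z = x then \<psi> y else 0)"
      by (intro sum.cong) (auto simp: basis_vec_def assign_inject)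
    then show ?thesis using x finite_states by simp
  next
    case False
    then have "\<psi> y = 0" "\<And>z. z \<in> states N \<Longrightarrow> basis_vec (assign z) y = 0"
      using assms zero_on_assign by (auto simp: supported_def basis_vec_def)
    then show ?thesis by simp
  qed
qed

lemma hoare_zero_above:
  assumes "\<And>g. g \<in> set gs \<Longrightarrow> target g < N"
  shows "hoare (zero_on {N..}) (apply_gates gs) (zero_on {N..})"
  by (rule hoare_apply_gates[OF ignores_zero_on[of _ "{..<N}"]]) (use assms in auto)

lemma hoare_layer_gates:
  assumes "layer_wf (\<lambda>_. 0) N L" "\<And>g. g \<in> set (layer_gates L) \<Longrightarrow> \<not> is_oracle g"
  shows "hoare (zero_on {N..}) (apply_gates (layer_gates L)) (zero_on {N..})"
  using assms target_in_glines by (intro hoare_zero_above) (auto simp: layer_wf_iff gate_wf_def)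

lemma circ_mat_eq_amplitude:
  assumes "\<And>L. L \<in> set C \<Longrightarrow> layer_wf (\<lambda>_. 0) N L \<and> (\<forall>g\<in>set (layer_gates L). \<not> is_oracle g)"
    and "x \<in> states N" "y \<in> states N"
  shows "circ_mat G N C y x = run_circuit C (basis_vec (assign x)) (assign y)"
  using assms(1,2)
proof (induction C arbitrary: x)
  case Nil
  then show ?case
    using assms(3) by (auto simp: run_circuit_def op_id_def basis_vec_def assign_inject)
next
  case (Cons L C)
  let ?\<psi> = "apply_gates (layer_gates L) (basis_vec (assign x))"
  have L: "layer_wf (\<lambda>_. 0) N L" "\<And>g. g \<in> set (layer_gates L) \<Longrightarrow> \<not> is_oracle g"
    using Cons.prems(1)[of L] by auto
  have "supported (zero_on {N..}) ?\<psi>"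
    using hoare_layer_gates[OF L] zero_on_assign[OF Cons.prems(2)] supported_basis_vec
    unfolding hoare_def by blast
  then have "run_circuit C ?\<psi> =
      run_circuit C (\<lambda>v. \<Sum>z\<in>states N. ?\<psi> (assign z) * basis_vec (assign z) v)"
    by (intro arg_cong[where f = "run_circuit C"] sum_basis_vec)
  also have "\<dots> = (\<lambda>v. \<Sum>z\<in>states N. ?\<psi> (assign z) * run_circuit C (basis_vec (assign z)) v)"
    by (rule run_circuit_sum)
  finally have "run_circuit (L # C) (basis_vec (assign x)) (assign y) =
      (\<Sum>z\<in>states N. ?\<psi> (assign z) * run_circuit C (basis_vec (assign z)) (assign y))"
    by (simp add: run_circuit_def)
  also have "\<dots> = (\<Sum>z\<in>states N. layer_mat G N L z x * circ_mat G N C y z)"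
  proof (intro sum.cong refl arg_cong2[where f = "(*)"])
    fix z assume z: "z \<in> states N"
    show "?\<psi> (assign z) = layer_mat G N L z x"
      by (rule layer_mat_eq_amplitude[OF L Cons.prems(2) z, symmetric])
    show "run_circuit C (basis_vec (assign z)) (assign y) = circ_mat G N C y z"
      by (rule Cons.IH[OF Cons.prems(1) z, symmetric]) simp
  qed
  also have "\<dots> = circ_mat G N (L # C) y x"
    by (simp add: op_mult_def mult.commute)
  finally show ?case ..
qed

section \<open>Operators with constant-depth circuits\<close>

definition adjoint :: "mat2 \<Rightarrow> mat2" where
  "adjoint U i j = cnj (U j i)"

fun adjoint_gate :: "gate \<Rightarrow> gate" where
  "adjoint_gate (OneQ U i) = OneQ (adjoint U) i"
| "adjoint_gate g = g"

lemma adjoint_adjoint [simp]: "adjoint (adjoint U) = U"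
  by (simp add: adjoint_def fun_eq_iff)

lemma unitary2_adjoint: "unitary2 U \<Longrightarrow> unitary2 (adjoint U)"
proof -
  have left_inverse_imp_right_inverse:
    "c' * a + d' * b = 0 \<and> a' * c + b' * d = 0 \<and> a * a' + b * b' = 1 \<and> c * c' + d * d' = 1"
    if "a' * a + c' * c = 1" "a' * b + c' * d = 0" "b' * a + d' * c = 0" "b' * b + d' * d = 1"
    for a b c d a' b' c' d' :: complex
    using that by algebra
  assume "unitary2 U"
  then show ?thesis
    using left_inverse_imp_right_inverse[of
        "cnj (U False False)" "U False False" "cnj (U True False)" "U True False"
        "U False True" "U True True" "cnj (U False True)" "cnj (U True True)"]
    by (simp add: unitary2_def adjoint_def UNIV_bool all_bool_eq mult.commute)
qed

lemma adjoint_gate_adjoint_gate [simp]: "adjoint_gate (adjoint_gate g) = g"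
  by (cases g) auto

lemma glines_adjoint_gate [simp]: "glines (adjoint_gate g) = glines g"
  by (cases g) auto

lemma target_adjoint_gate [simp]: "target (adjoint_gate g) = target g"
  by (cases g) auto

definition unitary_gate :: "gate \<Rightarrow> bool" where
  "unitary_gate g \<longleftrightarrow> distinct (glines g) \<and> (\<forall>U i. g = OneQ U i \<longrightarrow> unitary2 U)"

lemma target_entry_adjoint_gate:
  assumes "unitary_gate g"
  shows "target_entry (adjoint_gate g) y b = cnj (target_entry g (y(target g := b)) (y (target g)))"
proof (cases "classical g")
  case True
  then have "adjoint_gate g = g" by (cases g) (auto simp: classical_def)
  then show ?thesis
    using assms True by (auto simp: target_entry_classical toggles_target_upd unitary_gate_def)
next
  case False
  then show ?thesis by (auto simp: classical_def adjoint_def)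
qed

lemma target_entry_orthonormal:
  assumes "unitary_gate g"
  shows "(\<Sum>b\<in>UNIV. cnj (target_entry g (y(target g := b)) a) *
    target_entry g (y(target g := b)) c) = of_bool (a = c)"
proof (cases "classical g")
  case True
  then have "target_entry g (y(target g := b)) a = of_bool (a = (b \<noteq> toggles g y))" for a b
    using assms by (simp add: target_entry_classical toggles_target_upd unitary_gate_def)
  then show ?thesis by (cases a; cases c; cases "toggles g y") (simp_all add: UNIV_bool)
next
  case False
  then show ?thesis using assms by (auto simp: classical_def unitary_gate_def unitary2_def)
qed

lemma unitary_gate_adjoint_gate: "unitary_gate g \<Longrightarrow> unitary_gate (adjoint_gate g)"
  by (cases g) (auto simp: unitary_gate_def unitary2_adjoint)

lemma apply_adjoint_gate:
  assumes "unitary_gate g"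
  shows "apply_gate (adjoint_gate g) (apply_gate g \<psi>) = \<psi>"
proof
  fix y
  let ?t = "target g"
  let ?e = "\<lambda>b. target_entry g (y(?t := b))"
  have "apply_gate (adjoint_gate g) (apply_gate g \<psi>) y =
      (\<Sum>b\<in>UNIV. \<Sum>c\<in>UNIV. cnj (?e b (y ?t)) * ?e b c * \<psi> (y(?t := c)))"
    by (simp add: apply_gate_def target_entry_adjoint_gate[OF assms] sum_distrib_left mult.assoc)
  also have "\<dots> = (\<Sum>c\<in>UNIV. of_bool (y ?t = c) * \<psi> (y(?t := c)))"
    by (subst sum.swap) (simp only: target_entry_orthonormal[OF assms] flip: sum_distrib_right)
  also have "\<dots> = \<psi> y"
    by (cases "y ?t") (simp_all add: UNIV_bool fun_upd_idem)
  finally show "apply_gate (adjoint_gate g) (apply_gate g \<psi>) y = \<psi> y" .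
qed

lemma bij_apply_gate: "unitary_gate g \<Longrightarrow> bij (apply_gate g)"
  and inv_apply_gate: "unitary_gate g \<Longrightarrow> inv (apply_gate g) = apply_gate (adjoint_gate g)"
proof -
  assume g: "unitary_gate g"
  have inverse: "apply_gate (adjoint_gate g) (apply_gate g \<psi>) = \<psi>"
    "apply_gate g (apply_gate (adjoint_gate g) \<psi>) = \<psi>" for \<psi>
    using apply_adjoint_gate[OF g] apply_adjoint_gate[OF unitary_gate_adjoint_gate[OF g]]
    by simp_all
  show "bij (apply_gate g)" by (rule o_bij[of "apply_gate (adjoint_gate g)"]) (auto simp: inverse)
  show "inv (apply_gate g) = apply_gate (adjoint_gate g)"
    by (rule inv_equality) (auto simp: inverse)
qed

lemma bij_apply_gates: "\<forall>g\<in>set gs. unitary_gate g \<Longrightarrow> bij (apply_gates gs)"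
  by (induction gs) (auto simp del: comp_apply simp: fold_Cons bij_apply_gate intro!: bij_comp)

lemma inv_apply_gates:
  "\<forall>g\<in>set gs. unitary_gate g \<Longrightarrow> inv (apply_gates gs) = apply_gates (rev (map adjoint_gate gs))"
proof (induction gs)
  case (Cons g gs)
  then have "inv (apply_gates gs \<circ> apply_gate g) = inv (apply_gate g) \<circ> inv (apply_gates gs)"
    by (intro o_inv_distrib bij_apply_gates bij_apply_gate) auto
  then show ?case using Cons by (simp add: inv_apply_gate comp_def)
qed simp

lemma sorted_wrt_if_distinct:
  "distinct xs \<Longrightarrow> (\<And>x y. x \<in> set xs \<Longrightarrow> y \<in> set xs \<Longrightarrow> x \<noteq> y \<Longrightarrow> R x y) \<Longrightarrow> sorted_wrt R xs"
  by (induction xs) auto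

locale gate_basis =
  fixes q :: nat and S :: "mat2 set"
  assumes unitary: "U \<in> S \<Longrightarrow> unitary2 U" and adjoint_closed: "U \<in> S \<Longrightarrow> adjoint U \<in> S"
begin

text \<open>\<open>L\<close> contains the lines of the gate, \<open>W\<close> those that it may change.\<close>

definition gate_within :: "nat set \<Rightarrow> nat set \<Rightarrow> gate \<Rightarrow> bool" where
  "gate_within L W g \<longleftrightarrow> qaccq_gate q g \<and> (\<forall>U i. g = OneQ U i \<longrightarrow> U \<in> S) \<and>
     distinct (glines g) \<and> set (glines g) \<subseteq> L \<and> target g \<in> W"

definition circuit_within :: "nat set \<Rightarrow> nat set \<Rightarrow> gate list list \<Rightarrow> bool" where
  "circuit_within L W C \<longleftrightarrow> (\<forall>gs\<in>set C. disjoint_gates gs \<and> (\<forall>g\<in>set gs. gate_within L W g))"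

definition implementable :: "nat \<Rightarrow> nat set \<Rightarrow> nat set \<Rightarrow> (vec \<Rightarrow> vec) \<Rightarrow> bool" where
  "implementable d L W A \<longleftrightarrow> (\<exists>C. circuit_within L W C \<and> length C = d \<and> A = apply_gates (concat C))"

definition realizable ::
  "nat \<Rightarrow> nat set \<Rightarrow> nat set \<Rightarrow> (assignment \<Rightarrow> bool) \<Rightarrow> (vec \<Rightarrow> vec) \<Rightarrow> bool" where
  "realizable d L W P B \<longleftrightarrow> (\<exists>A. implementable d L W A \<and> (\<forall>\<psi>. supported P \<psi> \<longrightarrow> A \<psi> = B \<psi>))"

lemma gate_within_mono: "gate_within L W g \<Longrightarrow> L \<subseteq> L' \<Longrightarrow> W \<subseteq> W' \<Longrightarrow> gate_within L' W' g"
  by (auto simp: gate_within_def)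

lemma target_in_lines: "gate_within L W g \<Longrightarrow> target g \<in> L"
  using target_in_glines qaccq_gate_not_oracle by (auto simp: gate_within_def)

lemma gate_within_adjoint: "gate_within L W g \<Longrightarrow> gate_within L W (adjoint_gate g)"
  by (cases g) (auto simp: gate_within_def adjoint_closed qaccq_gate_def qac0_gate_def)

lemma gate_within_Toff:
  "gate_within L W (Toff cs t) \<longleftrightarrow> distinct cs \<and> t \<notin> set cs \<and> set cs \<subseteq> L \<and> t \<in> L \<and> t \<in> W"
  by (auto simp: gate_within_def qaccq_gate_def qac0_gate_def)

lemma gate_within_OneQ: "gate_within L W (OneQ U i) \<longleftrightarrow> U \<in> S \<and> i \<in> L \<and> i \<in> W"
  by (auto simp: gate_within_def qaccq_gate_def qac0_gate_def)

lemma gate_within_ModG: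
  "gate_within L W (ModG r ys t) \<longleftrightarrow> r = q \<and> distinct ys \<and> t \<notin> set ys \<and> set ys \<subseteq> L \<and> t \<in> L \<and> t \<in> W"
  by (auto simp: gate_within_def qaccq_gate_def qac0_gate_def)

lemma implementable_layer:
  "disjoint_gates gs \<Longrightarrow> (\<And>g. g \<in> set gs \<Longrightarrow> gate_within L W g) \<Longrightarrow> implementable 1 L W (apply_gates gs)"
  unfolding implementable_def circuit_within_def by (intro exI[of _ "[gs]"]) auto

lemma implementable_gate: "gate_within L W g \<Longrightarrow> implementable 1 L W (apply_gate g)"
  using implementable_layer[of "[g]"] by (simp add: disjoint_gates_def)

lemma implementable_id: "implementable 0 L W id"
  unfolding implementable_def circuit_within_def by (intro exI[of _ "[]"]) auto

lemma implementable_comp: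
  assumes "implementable d L W A" "implementable e L W B"
  shows "implementable (d + e) L W (B \<circ> A)"
proof -
  obtain C D where "circuit_within L W C" "length C = d" "A = apply_gates (concat C)"
    and "circuit_within L W D" "length D = e" "B = apply_gates (concat D)"
    using assms unfolding implementable_def by blast
  then show ?thesis
    unfolding implementable_def by (intro exI[of _ "C @ D"]) (auto simp: circuit_within_def)
qed

lemma implementable_mono:
  assumes "implementable d L W A" "d \<le> d'" "L \<subseteq> L'" "W \<subseteq> W'"
  shows "implementable d' L' W' A"
proof -
  obtain C where "circuit_within L W C" "length C = d" "A = apply_gates (concat C)"
    using assms(1) unfolding implementable_def by blast
  moreover have "concat (C @ replicate (d' - d) []) = concat C" by simp
  ultimately show ?thesis
    unfolding implementable_def using assms(2-4)
    by (intro exI[of _ "C @ replicate (d' - d) []"])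
      (auto simp: circuit_within_def disjoint_gates_def intro: gate_within_mono)
qed

lemma implementable_fold:
  assumes "\<And>i. i \<in> set is \<Longrightarrow> implementable d L W (A i)"
  shows "implementable (length is * d) L W (fold A is)"
  using assms
proof (induction "is")
  case Nil
  show ?case using implementable_id by (simp add: id_def)
next
  case (Cons i "is")
  have "implementable (d + length is * d) L W (fold A is \<circ> A i)"
    using Cons by (intro implementable_comp) auto
  then show ?case by (simp add: comp_def)
qed

lemma implementable_commute_diag:
  assumes "implementable d L W A" "ignores W f"
  shows "A (diag f \<psi>) = diag f (A \<psi>)"
proof -
  obtain C where C: "circuit_within L W C" "A = apply_gates (concat C)"
    using assms(1) unfolding implementable_def by blast
  show ?thesis
    unfolding C(2) by (rule apply_gates_diag[OF assms(2)])
      (use C(1) in \<open>auto simp: circuit_within_def gate_within_def\<close>)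
qed

lemma implementable_frame:
  assumes "implementable d L W A" "ignores W P"
  shows "hoare P A P"
proof -
  obtain C where C: "circuit_within L W C" "A = apply_gates (concat C)"
    using assms(1) unfolding implementable_def by blast
  show ?thesis
    unfolding C(2) by (rule hoare_apply_gates[OF assms(2)])
      (use C(1) in \<open>auto simp: circuit_within_def gate_within_def\<close>)
qed

lemma implementable_commute_gate:
  assumes "implementable d L W A" "W \<inter> insert (target h) (set (glines h)) = {}" "target h \<notin> L"
  shows "A \<circ> apply_gate h = apply_gate h \<circ> A"
proof -
  obtain C where C: "circuit_within L W C" "A = apply_gates (concat C)"
    using assms(1) unfolding implementable_def by blast
  have "apply_gates (concat C) \<circ> apply_gates [h] = apply_gates [h] \<circ> apply_gates (concat C)"
    by (rule apply_gates_commute)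
      (use C(1) assms(2,3) in \<open>fastforce simp: circuit_within_def gate_within_def\<close>)
  then show ?thesis by (simp add: C(2))
qed

lemma implementable_commute:
  assumes "implementable d L W A" "implementable e L' W' B" "L \<inter> L' = {}"
  shows "A \<circ> B = B \<circ> A"
proof -
  obtain C D where C: "circuit_within L W C" "A = apply_gates (concat C)"
    and D: "circuit_within L' W' D" "B = apply_gates (concat D)"
    using assms(1,2) unfolding implementable_def by blast
  show ?thesis
    unfolding C(2) D(2)
  proof (rule apply_gates_commute)
    fix g h assume "g \<in> set (concat C)" "h \<in> set (concat D)"
    then have "gate_within L W g" "gate_within L' W' h"
      using C(1) D(1) by (auto simp: circuit_within_def)
    then have "insert (target g) (set (glines g)) \<subseteq> L" "insert (target h) (set (glines h)) \<subseteq> L'"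
      using target_in_lines by (auto simp: gate_within_def)
    then show "target g \<notin> set (glines h) \<and> target h \<notin> set (glines g) \<and> target g \<noteq> target h"
      using assms(3) by blast
  qed
qed

lemma circuit_within_par:
  assumes "circuit_within L W C" "circuit_within L' W' D" "L \<inter> L' = {}"
  shows "circuit_within (L \<union> L') (W \<union> W') (map2 (@) C D)"
  unfolding circuit_within_def
proof (rule ballI)
  fix gs assume "gs \<in> set (map2 (@) C D)"
  then obtain c d where gs: "c \<in> set C" "d \<in> set D" "gs = c @ d"
    by (auto dest: set_zip_leftD set_zip_rightD)
  then have c: "disjoint_gates c" "\<And>g. g \<in> set c \<Longrightarrow> gate_within L W g"
    and d: "disjoint_gates d" "\<And>g. g \<in> set d \<Longrightarrow> gate_within L' W' g"
    using assms(1,2) by (auto simp: circuit_within_def)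
  have "disjnt (set (glines g)) (set (glines h))" if "g \<in> set c" "h \<in> set d" for g h
    using c(2)[OF that(1)] d(2)[OF that(2)] assms(3) by (auto simp: gate_within_def disjnt_def)
  then have "disjoint_gates gs"
    using c(1) d(1) by (simp add: gs(3) disjoint_gates_def sorted_wrt_append)
  then show "disjoint_gates gs \<and> (\<forall>g\<in>set gs. gate_within (L \<union> L') (W \<union> W') g)"
    using c(2) d(2) by (auto simp: gs(3) intro: gate_within_mono)
qed

lemma implementable_par:
  assumes "implementable d L W A" "implementable d L' W' B" "L \<inter> L' = {}"
  shows "implementable d (L \<union> L') (W \<union> W') (B \<circ> A)"
proof -
  obtain C D where C: "circuit_within L W C" "length C = d" "A = apply_gates (concat C)"
    and D: "circuit_within L' W' D" "length D = d" "B = apply_gates (concat D)"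
    using assms(1,2) unfolding implementable_def by blast
  have "apply_gates (concat (map2 (@) C D)) = apply_gates (concat D) \<circ> apply_gates (concat C)"
    using C(2)[folded D(2)] C(1) D(1)
  proof (induction C D rule: list_induct2)
    case (Cons c C d D)
    have "implementable (length C) L W (apply_gates (concat C))"
      using Cons.prems by (auto simp: implementable_def circuit_within_def)
    moreover have "implementable 1 L' W' (apply_gates d)"
      using Cons.prems by (intro implementable_layer) (auto simp: circuit_within_def)
    ultimately have "apply_gates (concat C) \<circ> apply_gates d =
        apply_gates d \<circ> apply_gates (concat C)"
      using assms(3) by (rule implementable_commute)
    then have "apply_gates (concat C) (apply_gates d \<psi>) =
        apply_gates d (apply_gates (concat C) \<psi>)" for \<psi>
      by (metis comp_apply)
    then show ?case using Cons by (simp add: circuit_within_def comp_def)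
  qed simp
  then show ?thesis
    unfolding implementable_def using circuit_within_par[OF C(1) D(1) assms(3)] C(2,3) D(2,3)
    by (intro exI[of _ "map2 (@) C D"]) simp
qed

lemma implementable_parallel:
  assumes "\<And>i. i \<in> set is \<Longrightarrow> implementable d (L i) (W i) (A i)"
    and "sorted_wrt (\<lambda>i j. disjnt (L i) (L j)) is"
  shows "implementable d (\<Union>i\<in>set is. L i) (\<Union>i\<in>set is. W i) (fold A is)"
  using assms
proof (induction "is")
  case Nil
  show ?case using implementable_mono[OF implementable_id] by (simp add: id_def)
next
  case (Cons i "is")
  have "implementable d (L i \<union> (\<Union>i\<in>set is. L i)) (W i \<union> (\<Union>i\<in>set is. W i)) (fold A is \<circ> A i)"
    using Cons by (intro implementable_par) (auto simp: disjnt_def)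
  then show ?case by (simp add: comp_def)
qed

lemma
  assumes "implementable d L W A"
  shows implementable_bij: "bij A" and implementable_inv: "implementable d L W (inv A)"
proof -
  obtain C where C: "circuit_within L W C" "length C = d" "A = apply_gates (concat C)"
    using assms unfolding implementable_def by blast
  let ?D = "rev (map (\<lambda>gs. rev (map adjoint_gate gs)) C)"
  have unitary_gates: "\<forall>g\<in>set (concat C). unitary_gate g"
    using C(1) unitary by (fastforce simp: circuit_within_def gate_within_def unitary_gate_def)
  then show "bij A" unfolding C(3) by (rule bij_apply_gates)
  have "rev (map adjoint_gate (concat C)) = concat ?D" by (induction C) auto
  then have "inv A = apply_gates (concat ?D)"
    unfolding C(3) using inv_apply_gates[OF unitary_gates] by simp
  moreover have "disjoint_gates (rev (map adjoint_gate gs)) = disjoint_gates gs" for gs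
    by (simp add: disjoint_gates_def sorted_wrt_rev sorted_wrt_map disjnt_def Int_commute)
  then have "circuit_within L W ?D"
    using C(1) gate_within_adjoint by (auto simp: circuit_within_def)
  ultimately show "implementable d L W (inv A)"
    unfolding implementable_def using C(2) by (intro exI[of _ ?D]) simp
qed

lemma realizable_mono:
  assumes "realizable d L W P A" "d \<le> d'" "L \<subseteq> L'" "W \<subseteq> W'" "\<And>y. P' y \<Longrightarrow> P y"
  shows "realizable d' L' W' P' A"
  using assms implementable_mono supported_mono unfolding realizable_def by metis

lemma realizable_cong:
  assumes "realizable d L W P A" "\<And>\<psi>. supported P \<psi> \<Longrightarrow> A \<psi> = B \<psi>"
  shows "realizable d L W P B"
  using assms unfolding realizable_def by auto

lemma implementable_realizable: "implementable d L W A \<Longrightarrow> realizable d L W P A"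
  unfolding realizable_def by blast

lemma realizable_fold:
  assumes "\<And>i. i \<in> set is \<Longrightarrow> realizable d L W P (B i) \<and> hoare P (B i) P"
  shows "realizable (length is * d) L W P (fold B is)"
proof -
  obtain A where A: "\<And>i. i \<in> set is \<Longrightarrow> implementable d L W (A i)"
    "\<And>i \<psi>. i \<in> set is \<Longrightarrow> supported P \<psi> \<Longrightarrow> A i \<psi> = B i \<psi>"
    using assms unfolding realizable_def by metis
  have "fold A is \<psi> = fold B is \<psi>" if "supported P \<psi>" for \<psi>
    by (rule fold_cong_supported[OF A(2) _ that]) (use assms in auto)
  then show ?thesis
    unfolding realizable_def using implementable_fold[of "is" d L W A] A(1) by blast
qed

lemma realizable_parallel:
  assumes "\<And>i. i \<in> set is \<Longrightarrow> realizable d (L i) (W i) P (B i) \<and> hoare P (B i) P"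
    and "sorted_wrt (\<lambda>i j. disjnt (L i) (L j)) is"
  shows "realizable d (\<Union>i\<in>set is. L i) (\<Union>i\<in>set is. W i) P (fold B is)"
proof -
  obtain A where A: "\<And>i. i \<in> set is \<Longrightarrow> implementable d (L i) (W i) (A i)"
    "\<And>i \<psi>. i \<in> set is \<Longrightarrow> supported P \<psi> \<Longrightarrow> A i \<psi> = B i \<psi>"
    using assms(1) unfolding realizable_def by metis
  have "fold A is \<psi> = fold B is \<psi>" if "supported P \<psi>" for \<psi>
    by (rule fold_cong_supported[OF A(2) _ that]) (use assms in auto)
  then show ?thesis
    unfolding realizable_def using implementable_parallel[of "is" d L W A] A(1) assms(2) by blast
qed

lemma realizable_conjugate:
  assumes A: "implementable a L W A" "hoare P A Q" and B: "realizable d L W Q B"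
    and commute: "A \<circ> B = B \<circ> A"
  shows "realizable (2 * a + d) L W P B"
proof -
  obtain B' where B': "implementable d L W B'" "\<And>\<psi>. supported Q \<psi> \<Longrightarrow> B' \<psi> = B \<psi>"
    using B unfolding realizable_def by blast
  have "implementable (a + d + a) L W (inv A \<circ> (B' \<circ> A))"
    by (intro implementable_comp A(1) B'(1) implementable_inv)
  moreover have "(inv A \<circ> (B' \<circ> A)) \<psi> = B \<psi>" if "supported P \<psi>" for \<psi>
  proof -
    have "B' (A \<psi>) = A (B \<psi>)"
      using B'(2) A(2) that fun_cong[OF commute, of \<psi>] by (simp add: hoare_def)
    then show ?thesis using implementable_bij[OF A(1)] by (simp add: bij_is_inj)
  qed
  ultimately show ?thesis
    unfolding realizable_def by (intro exI[of _ "inv A \<circ> (B' \<circ> A)"]) (simp add: mult_2 add_ac)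
qed

end

section \<open>Negation and disjunction\<close>

definition negate :: "nat list \<Rightarrow> vec \<Rightarrow> vec" where
  "negate ls = apply_gates (map (Toff []) ls)"

lemma negate_apply: "distinct ls \<Longrightarrow> negate ls \<psi> y = \<psi> (\<lambda>l. y l \<noteq> (l \<in> set ls))"
proof (induction ls arbitrary: \<psi>)
  case (Cons l ls)
  then have "negate (l # ls) \<psi> y = \<psi> ((\<lambda>i. y i \<noteq> (i \<in> set ls))(l := \<not> y l))"
    by (simp add: negate_def apply_classical)
  also have "(\<lambda>i. y i \<noteq> (i \<in> set ls))(l := \<not> y l) = (\<lambda>i. y i \<noteq> (i \<in> set (l # ls)))"
    using Cons.prems by (auto simp: fun_eq_iff)
  finally show ?case .
qed (simp add: negate_def)

lemma hoare_negate:
  assumes "distinct ls" "\<And>y. P y \<Longrightarrow> Q (\<lambda>l. y l \<noteq> (l \<in> set ls))"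
  shows "hoare P (negate ls) Q"
  unfolding hoare_def supported_def negate_apply[OF assms(1)]
proof (intro allI impI)
  fix \<psi> :: vec and y
  assume "\<forall>y. \<psi> y \<noteq> 0 \<longrightarrow> P y" "\<psi> (\<lambda>l. y l \<noteq> (l \<in> set ls)) \<noteq> 0"
  then have "Q (\<lambda>l. (y l \<noteq> (l \<in> set ls)) \<noteq> (l \<in> set ls))" by (intro assms(2)) simp
  moreover have "(\<lambda>l. (y l \<noteq> (l \<in> set ls)) \<noteq> (l \<in> set ls)) = y" by auto
  ultimately show "Q y" by simp
qed

definition or_gate :: "nat list \<Rightarrow> nat \<Rightarrow> vec \<Rightarrow> vec" where
  "or_gate cs t = negate cs \<circ> apply_gate (Toff cs t) \<circ> negate (t # cs)"

lemma or_gate_apply: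
  assumes "distinct (t # cs)"
  shows "or_gate cs t \<psi> y = \<psi> (y(t := (y t \<noteq> (\<exists>c\<in>set cs. y c))))"
proof -
  have "or_gate cs t \<psi> y = \<psi> (\<lambda>l. ((\<lambda>l. y l \<noteq> (l \<in> set cs))
      (t := (y t \<noteq> (\<forall>c\<in>set cs. \<not> y c)))) l \<noteq> (l \<in> set (t # cs)))"
    using assms by (simp add: or_gate_def negate_apply apply_classical)
  also have "(\<lambda>l. ((\<lambda>l. y l \<noteq> (l \<in> set cs))(t := (y t \<noteq> (\<forall>c\<in>set cs. \<not> y c)))) l \<noteq>
      (l \<in> set (t # cs))) = y(t := (y t \<noteq> (\<exists>c\<in>set cs. y c)))"
    using assms by (auto simp: fun_eq_iff)
  finally show ?thesis .
qed

lemma hoare_or_gate: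
  assumes "distinct (t # cs)" "\<And>y. P y \<Longrightarrow> Q (y(t := (y t \<noteq> (\<exists>c\<in>set cs. y c))))"
  shows "hoare P (or_gate cs t) Q"
  using or_gate_apply[OF assms(1)] _ assms(2)
proof (rule hoare_toggle)
  show "(\<exists>c\<in>set cs. (y(t := b)) c) = (\<exists>c\<in>set cs. y c)" for y b
    using assms(1) by auto
qed

context gate_basis
begin

lemma implementable_negate:
  assumes "distinct ls"
  shows "implementable 1 (set ls) (set ls) (negate ls)"
  unfolding negate_def
proof (rule implementable_layer)
  show "disjoint_gates (map (Toff []) ls)"
    unfolding disjoint_gates_def sorted_wrt_map
    by (rule sorted_wrt_if_distinct[OF assms]) simp
qed (auto simp: gate_within_Toff)

lemma implementable_or_gate:
  assumes "distinct (t # cs)"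
  shows "implementable 3 (insert t (set cs)) (insert t (set cs)) (or_gate cs t)"
proof -
  let ?L = "insert t (set cs)"
  have toff: "implementable 1 ?L ?L (apply_gate (Toff cs t))"
    using assms by (intro implementable_gate) (auto simp: gate_within_Toff)
  have neg: "implementable 1 ?L ?L (negate ls)" if "distinct ls" "set ls \<subseteq> ?L" for ls
    by (rule implementable_mono[OF implementable_negate]) (use that in auto)
  have "implementable (1 + 1 + 1) ?L ?L (or_gate cs t)"
    unfolding or_gate_def comp_assoc
    by (rule implementable_comp[OF implementable_comp[OF neg toff] neg]) (use assms in auto)
  then show ?thesis by (simp add: numeral_3_eq_3)
qed

end

section \<open>Registers holding a uniformly distributed digit\<close>

definition rotation :: "nat \<Rightarrow> mat2" where
  "rotation n b a = complex_of_real
     (if b = a then sqrt (1 / (real n + 2))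
      else if b then sqrt ((real n + 1) / (real n + 2)) else - sqrt ((real n + 1) / (real n + 2)))"

text \<open>The angles make the number of leading ones of \<open>k\<close> lines, initially zero, uniformly
  distributed on \<open>{0..k}\<close>.\<close>

primrec spread :: "nat list \<Rightarrow> vec \<Rightarrow> vec" where
  "spread [] = id"
| "spread (l # ls) = spread ls \<circ> apply_gate (OneQ (rotation (length ls)) l)"

definition leading_ones :: "nat list \<Rightarrow> assignment \<Rightarrow> nat" where
  "leading_ones ls y = length (takeWhile y ls)"

definition weight :: "nat list \<Rightarrow> assignment \<Rightarrow> nat" where
  "weight ls y = length (filter y ls)"

fun unary_gates :: "nat list \<Rightarrow> nat list \<Rightarrow> nat list \<Rightarrow> gate list" where
  "unary_gates cs (d # ds) (u # us) = Toff (cs @ [d]) u # unary_gates (cs @ [d]) ds us"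
| "unary_gates cs [] us = []"
| "unary_gates cs ds [] = []"

abbreviation unary :: "nat list \<Rightarrow> nat list \<Rightarrow> vec \<Rightarrow> vec" where
  "unary ds us \<equiv> apply_gates (unary_gates [] ds us)"

definition power_mean :: "complex \<Rightarrow> nat \<Rightarrow> complex" where
  "power_mean a n = (\<Sum>k\<le>n. a ^ k) / of_nat (n + 1)"

definition prepare :: "nat list \<Rightarrow> nat list \<Rightarrow> vec \<Rightarrow> vec" where
  "prepare ds us = unary ds us \<circ> spread ds"

definition register_test :: "vec \<Rightarrow> nat list \<Rightarrow> nat list \<Rightarrow> vec \<Rightarrow> vec" where
  "register_test \<alpha> ds us =
     inv (prepare ds us) \<circ> diag (\<lambda>y. \<alpha> y ^ weight us y) \<circ> prepare ds us"

lemma rotation_norm_square: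
  "cnj (rotation n b False) * rotation n b False = of_nat (if b then n + 1 else 1) / of_nat (n + 2)"
  by (simp add: rotation_def add.commute flip: of_real_mult)

lemma unitary2_rotation: "unitary2 (rotation n)"
proof -
  have "cnj (rotation n False False) * rotation n False False +
      cnj (rotation n True False) * rotation n True False = of_nat (n + 2) / of_nat (n + 2)"
    unfolding rotation_norm_square by (simp flip: add_divide_distrib)
  also have "\<dots> = 1" by (simp only: divide_self of_nat_eq_0_iff)
  finally show ?thesis
    by (simp add: unitary2_def rotation_def UNIV_bool all_bool_eq add.commute mult.commute)
qed

lemma unitary_gate_rotation: "unitary_gate (OneQ (rotation n) l)"
  by (simp add: unitary_gate_def unitary2_rotation)

lemma ignores_weight: "set ls \<inter> W = {} \<Longrightarrow> ignores W (weight ls)"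
  unfolding weight_def by (rule ignoresI, rule arg_cong[where f = length], rule filter_cong) auto

lemma ignores_leading_ones: "set ls \<inter> W = {} \<Longrightarrow> ignores W (leading_ones ls)"
  unfolding leading_ones_def
  by (rule ignoresI, rule arg_cong[where f = length], rule takeWhile_cong) auto

lemma bij_spread: "bij (spread ls)"
proof (induction ls)
  case Nil
  show ?case by (simp only: spread.simps bij_id)
next
  case (Cons l ls)
  then show ?case
    unfolding spread.simps by (intro bij_comp bij_apply_gate unitary_gate_rotation)
qed

lemma spread_diag: "ignores (set ls) f \<Longrightarrow> spread ls (diag f \<psi>) = diag f (spread ls \<psi>)"
proof (induction ls arbitrary: \<psi>)
  case (Cons l ls)
  let ?V = "OneQ (rotation (length ls)) l"
  have "apply_gate ?V (diag f \<psi>) = diag f (apply_gate ?V \<psi>)"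
    using apply_gates_diag[OF Cons.prems, of "[?V]"] by simp
  moreover have "ignores (set ls) f" by (rule ignores_subset[OF Cons.prems]) auto
  ultimately show ?case using Cons.IH by simp
qed simp

lemma hoare_spread:
  assumes "ignores (set ls) P"
  shows "hoare P (spread ls) P"
  using spread_diag[OF ignores_compose[OF assms], of of_bool, symmetric]
  by (simp add: hoare_def supported_iff_diag)

lemma power_mean_1: "power_mean 1 n = 1"
  using of_nat_neq_0[where ?'a = complex, of n] by (simp add: power_mean_def add.commute)

lemma power_mean_Suc:
  "power_mean a (Suc n) = (1 + of_nat (n + 1) * (power_mean a n * a)) / of_nat (n + 2)"
proof -
  have "b * (x / b * a) = a * x" if "b \<noteq> 0" for b x :: complex
    using that by simp
  from this[of "of_nat (n + 1)"] have "of_nat (n + 1) * (power_mean a n * a) = a * (\<Sum>k\<le>n. a ^ k)"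
    unfolding power_mean_def by (simp only: of_nat_eq_0_iff)
  then show ?thesis
    by (simp add: power_mean_def sum_distrib_left sum.atMost_Suc_shift del: sum.atMost_Suc)
qed

lemma power_mean_eq_0: "a \<noteq> 1 \<Longrightarrow> a ^ (n + 1) = 1 \<Longrightarrow> power_mean a n = 0"
  using sum_gp_basic[of a n] by (simp add: power_mean_def)

lemma rotation_mean:
  assumes "\<not> y l" "\<psi> (y(l := True)) = 0"
    and "\<And>b. \<chi> (y(l := b)) = M b * apply_gate (OneQ (rotation n) l) \<psi> (y(l := b))"
  shows "apply_gate (adjoint_gate (OneQ (rotation n) l)) \<chi> y =
    (M False + of_nat (n + 1) * M True) / of_nat (n + 2) * \<psi> y"
proof -
  have rotated: "apply_gate (OneQ (rotation n) l) \<psi> (y(l := b)) = rotation n b False * \<psi> y" for b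
    using assms(1,2) by (simp add: apply_gate_def UNIV_bool fun_upd_idem)
  have "apply_gate (adjoint_gate (OneQ (rotation n) l)) \<chi> y =
      (\<Sum>b\<in>UNIV. cnj (rotation n b False) * \<chi> (y(l := b)))"
    using assms(1) by (simp add: apply_gate_def adjoint_def)
  also have "\<dots> = (\<Sum>b\<in>UNIV. cnj (rotation n b False) * rotation n b False * (M b * \<psi> y))"
    unfolding assms(3) rotated by (simp add: mult_ac)
  also have "\<dots> = (M False + of_nat (n + 1) * M True) / of_nat (n + 2) * \<psi> y"
    unfolding rotation_norm_square by (simp add: UNIV_bool add_divide_distrib distrib_right)
  finally show ?thesis .
qed

lemma inv_spread_Cons_phase:
  fixes \<alpha> :: vec
  assumes "l \<notin> set ls" "ignores (set ls) \<alpha>"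
  defines "\<beta> \<equiv> \<lambda>y. if y l then \<alpha> y else 1" and "V \<equiv> OneQ (rotation (length ls)) l"
  shows "inv (spread (l # ls)) (diag (\<lambda>y. \<alpha> y ^ leading_ones (l # ls) y) (spread (l # ls) \<psi>)) =
    apply_gate (adjoint_gate V) (inv (spread ls)
      (diag (\<lambda>y. \<beta> y ^ leading_ones ls y) (spread ls (diag \<beta> (apply_gate V \<psi>)))))"
proof -
  have "ignores (set ls) \<beta>"
    unfolding \<beta>_def by (rule ignores_compose2[OF ignores_line[OF assms(1)] assms(2)])
  then have "diag (\<lambda>y. \<alpha> y ^ leading_ones (l # ls) y) (spread ls \<phi>) =
      diag (\<lambda>y. \<beta> y ^ leading_ones ls y) (spread ls (diag \<beta> \<phi>))" for \<phi>
    by (auto simp: spread_diag diag_comp \<beta>_def leading_ones_def diag_def fun_eq_iff)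
  then show ?thesis
    using o_inv_distrib[OF bij_spread bij_apply_gate[OF unitary_gate_rotation]]
    by (simp add: V_def inv_apply_gate[OF unitary_gate_rotation])
qed

lemma digit_amplitude:
  assumes "distinct ls" "supported (zero_on (set ls)) \<psi>" "ignores (set ls) \<alpha>" "zero_on (set ls) y"
  shows "inv (spread ls) (diag (\<lambda>y. \<alpha> y ^ leading_ones ls y) (spread ls \<psi>)) y =
    power_mean (\<alpha> y) (length ls) * \<psi> y"
  using assms
proof (induction ls arbitrary: \<psi> \<alpha> y)
  case Nil
  then show ?case by (simp add: diag_def leading_ones_def power_mean_def)
next
  case (Cons l ls)
  let ?V = "OneQ (rotation (length ls)) l" and ?\<beta> = "\<lambda>y. if y l then \<alpha> y else 1"
  let ?\<psi> = "diag ?\<beta> (apply_gate ?V \<psi>)"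
  let ?\<chi> = "inv (spread ls) (diag (\<lambda>y. ?\<beta> y ^ leading_ones ls y) (spread ls ?\<psi>))"
  let ?M = "\<lambda>b. power_mean (if b then \<alpha> y else 1) (length ls) * (if b then \<alpha> y else 1)"
  have l: "l \<notin> set ls" "distinct ls" using Cons.prems(1) by auto
  have \<alpha>: "ignores (set ls) \<alpha>" by (rule ignores_subset[OF Cons.prems(3)]) auto
  have \<beta>: "ignores (set ls) ?\<beta>"
    by (rule ignores_compose2[OF ignores_line[OF l(1)] \<alpha>])
  have "supported (zero_on (set ls)) \<psi>"
    using Cons.prems(2) by (rule supported_mono) (auto simp: zero_on_def)
  moreover have "hoare (zero_on (set ls)) (apply_gates [?V]) (zero_on (set ls))"
    by (rule hoare_apply_gates[of "{l}"]) (use l in \<open>auto intro: ignores_zero_on\<close>)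
  ultimately have supported: "supported (zero_on (set ls)) ?\<psi>"
    using hoare_diag by (simp add: hoare_def)
  have "?\<chi> (y(l := b)) = ?M b * apply_gate ?V \<psi> (y(l := b))" for b
  proof -
    have "\<alpha> (y(l := c)) = \<alpha> y" for c by (rule ignores_fun_upd[OF Cons.prems(3)]) simp
    moreover have "zero_on (set ls) (y(l := b))" using Cons.prems(4) l by (auto simp: zero_on_def)
    then have "?\<chi> (y(l := b)) = power_mean (?\<beta> (y(l := b))) (length ls) * ?\<psi> (y(l := b))"
      by (rule Cons.IH[OF l(2) supported \<beta>])
    ultimately show ?thesis by (simp add: diag_def)
  qed
  moreover have "\<not> zero_on (set (l # ls)) (y(l := True))" by (simp add: zero_on_def)
  then have "\<psi> (y(l := True)) = 0" using Cons.prems(2) by (auto simp: supported_def)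
  moreover have "\<not> y l" using Cons.prems(4) by (simp add: zero_on_def)
  ultimately have "apply_gate (adjoint_gate ?V) ?\<chi> y =
      (?M False + of_nat (length ls + 1) * ?M True) / of_nat (length ls + 2) * \<psi> y"
    by (intro rotation_mean)
  also have "\<dots> = power_mean (\<alpha> y) (length (l # ls)) * \<psi> y"
    by (simp add: power_mean_1 power_mean_Suc)
  finally show ?case unfolding inv_spread_Cons_phase[OF l(1) \<alpha>] .
qed

lemma hoare_digit_test:
  assumes "distinct ls" "ignores (set ls) \<alpha>" and root: "\<And>y. \<alpha> y ^ (length ls + 1) = (1 :: complex)"
  shows "hoare (zero_on (set ls)) (inv (spread ls) \<circ> diag (\<lambda>y. \<alpha> y ^ leading_ones ls y) \<circ> spread ls)
    (\<lambda>y. zero_on (set ls) y \<longleftrightarrow> \<alpha> y = 1)"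
  unfolding hoare_def
proof (intro allI impI)
  fix \<psi> assume \<psi>: "supported (zero_on (set ls)) \<psi>"
  define \<chi> where "\<chi> = inv (spread ls) (diag (\<lambda>y. \<alpha> y ^ leading_ones ls y) (spread ls \<psi>))"
  have "\<chi> y = 0" if "\<alpha> y \<noteq> 1" "zero_on (set ls) y" for y
    using digit_amplitude[OF assms(1) \<psi> assms(2) that(2)] power_mean_eq_0[OF that(1) root]
    by (simp add: \<chi>_def)
  moreover have "\<chi> y = \<psi> y" if "\<alpha> y = 1" for y
  proof -
    let ?P = "\<lambda>y. of_bool (\<alpha> y = 1)"
    have P: "ignores (set ls) ?P" by (rule ignores_compose[OF assms(2)])
    have "spread ls (diag ?P \<chi>) = diag ?P (diag (\<lambda>y. \<alpha> y ^ leading_ones ls y) (spread ls \<psi>))"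
      unfolding spread_diag[OF P] \<chi>_def using bij_spread by (simp add: bij_is_surj surj_f_inv_f)
    also have "\<dots> = spread ls (diag ?P \<psi>)"
      unfolding spread_diag[OF P] diag_comp by (auto simp: diag_def fun_eq_iff)
    finally have "diag ?P \<chi> = diag ?P \<psi>" using bij_spread by (simp add: bij_is_inj inj_eq)
    then show ?thesis using that by (auto simp: diag_def dest: fun_cong[where x = y])
  qed
  ultimately have "supported (\<lambda>y. zero_on (set ls) y \<longleftrightarrow> \<alpha> y = 1) \<chi>"
    using \<psi> unfolding supported_def by metis
  then show "supported (\<lambda>y. zero_on (set ls) y \<longleftrightarrow> \<alpha> y = 1)
      ((inv (spread ls) \<circ> diag (\<lambda>y. \<alpha> y ^ leading_ones ls y) \<circ> spread ls) \<psi>)"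
    by (simp add: \<chi>_def)
qed

context gate_basis
begin

lemma implementable_spread:
  assumes "distinct ls" "\<And>n. n < length ls \<Longrightarrow> rotation n \<in> S"
  shows "implementable 1 (set ls) (set ls) (spread ls)"
  using assms
proof (induction ls)
  case Nil
  show ?case using implementable_mono[OF implementable_id] by (simp add: id_def)
next
  case (Cons l ls)
  have "implementable 1 {l} {l} (apply_gate (OneQ (rotation (length ls)) l))"
    using Cons.prems(2) by (intro implementable_gate) (simp add: gate_within_OneQ)
  moreover have "implementable 1 (set ls) (set ls) (spread ls)"
    using Cons by auto
  ultimately have "implementable 1 ({l} \<union> set ls) ({l} \<union> set ls)
      (spread ls \<circ> apply_gate (OneQ (rotation (length ls)) l))"
    by (rule implementable_par) (use Cons.prems(1) in auto)
  then show ?case by (simp add: comp_def)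
qed

lemma implementable_unary:
  assumes "distinct (cs @ ds @ us)" "length us = length ds"
  shows "implementable (length ds) (set cs \<union> set ds \<union> set us) (set us)
    (apply_gates (unary_gates cs ds us))"
  using assms
proof (induction cs ds us rule: unary_gates.induct)
  case (1 cs d ds u us)
  let ?L = "set cs \<union> set (d # ds) \<union> set (u # us)"
  have "implementable 1 ?L (set (u # us)) (apply_gate (Toff (cs @ [d]) u))"
    using "1.prems" by (intro implementable_gate) (auto simp: gate_within_Toff)
  moreover have "implementable (length ds) ?L (set (u # us))
      (apply_gates (unary_gates (cs @ [d]) ds us))"
    by (rule implementable_mono[OF "1.IH"]) (use "1.prems" in auto)
  ultimately have "implementable (1 + length ds) ?L (set (u # us))
      (apply_gates (unary_gates (cs @ [d]) ds us) \<circ> apply_gate (Toff (cs @ [d]) u))"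
    by (rule implementable_comp)
  then show ?case by (simp add: comp_def)
qed (use implementable_id in \<open>auto simp: id_def\<close>)

lemma hoare_unary:
  assumes "distinct (cs @ ds @ us)" "length us = length ds"
  shows "hoare (zero_on (set us)) (apply_gates (unary_gates cs ds us))
    (\<lambda>y. weight us y = (if \<forall>c\<in>set cs. y c then leading_ones ds y else 0))"
  using assms
proof (induction cs ds us rule: unary_gates.induct)
  case (1 cs d ds u us)
  let ?ones = "\<lambda>y. \<forall>c\<in>set (cs @ [d]). y c"
  let ?rest = "apply_gates (unary_gates (cs @ [d]) ds us)"
  have dist: "distinct ((cs @ [d]) @ ds @ us)" "length us = length ds" using "1.prems" by auto
  have "hoare (zero_on (set (u # us))) (apply_gate (Toff (cs @ [d]) u))
      (\<lambda>y. (y u \<longleftrightarrow> ?ones y) \<and> zero_on (set us) y)"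
    by (rule hoare_classical) (use "1.prems" in \<open>auto simp: zero_on_def\<close>)
  moreover have "ignores (set us) (\<lambda>y. y u \<longleftrightarrow> ?ones y)"
    using "1.prems"
    by (intro ignores_compose2[where h = "(=)"] ignores_line ignores_ball) auto
  then have "hoare (\<lambda>y. y u \<longleftrightarrow> ?ones y) ?rest (\<lambda>y. y u \<longleftrightarrow> ?ones y)"
    by (rule implementable_frame[OF implementable_unary[OF dist]])
  then have "hoare (\<lambda>y. (y u \<longleftrightarrow> ?ones y) \<and> zero_on (set us) y) ?rest
      (\<lambda>y. (y u \<longleftrightarrow> ?ones y) \<and> weight us y = (if ?ones y then leading_ones ds y else 0))"
    using "1.IH"[OF dist] by (rule hoare_conj)
  ultimately have "hoare (zero_on (set (u # us))) (apply_gates (unary_gates cs (d # ds) (u # us)))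
      (\<lambda>y. (y u \<longleftrightarrow> ?ones y) \<and> weight us y = (if ?ones y then leading_ones ds y else 0))"
    by (simp add: hoare_def)
  then show ?case
    by (rule hoare_mono) (auto simp: weight_def leading_ones_def split: if_splits)
qed (auto simp: hoare_def supported_def weight_def leading_ones_def)

lemma inv_unary_phase:
  assumes "distinct (ds @ us)" "length us = length ds" "ignores (set us) \<alpha>"
    and "supported (zero_on (set us)) \<psi>"
  shows "inv (unary ds us) (diag (\<lambda>y. \<alpha> y ^ weight us y) (unary ds us \<psi>)) =
    diag (\<lambda>y. \<alpha> y ^ leading_ones ds y) \<psi>"
proof -
  have unary: "implementable (length ds) (set ds \<union> set us) (set us) (unary ds us)"
    using implementable_unary[of "[]" ds us] assms(1,2) by simp
  have "supported (\<lambda>y. weight us y = leading_ones ds y) (unary ds us \<psi>)"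
    using hoare_unary[of "[]" ds us] assms(1,2,4) by (simp add: hoare_def)
  then have "diag (\<lambda>y. \<alpha> y ^ weight us y) (unary ds us \<psi>) =
      diag (\<lambda>y. \<alpha> y ^ leading_ones ds y) (unary ds us \<psi>)"
    by (rule diag_cong_supported) simp
  also have "\<dots> = unary ds us (diag (\<lambda>y. \<alpha> y ^ leading_ones ds y) \<psi>)"
    by (rule implementable_commute_diag[OF unary, symmetric])
      (rule ignores_compose2[OF assms(3) ignores_leading_ones], use assms(1) in auto)
  finally show ?thesis using implementable_bij[OF unary] by (simp add: bij_is_inj)
qed

lemma implementable_prepare:
  assumes "distinct (ds @ us)" "length us = length ds" "\<And>n. n < length ds \<Longrightarrow> rotation n \<in> S"
  shows "implementable (length ds + 1) (set ds \<union> set us) (set ds \<union> set us) (prepare ds us)"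
proof -
  let ?L = "set ds \<union> set us"
  have "implementable 1 ?L ?L (spread ds)"
    by (rule implementable_mono[OF implementable_spread]) (use assms in auto)
  moreover have "implementable (length ds) ?L ?L (unary ds us)"
    by (rule implementable_mono[OF implementable_unary]) (use assms in auto)
  ultimately show ?thesis unfolding prepare_def using implementable_comp by fastforce
qed

lemma hoare_register_test:
  assumes "distinct (ds @ us)" "length us = length ds"
    and \<alpha>: "ignores (set ds \<union> set us) \<alpha>" "\<And>y. \<alpha> y ^ (length ds + 1) = 1"
  shows "hoare (zero_on (set ds \<union> set us)) (register_test \<alpha> ds us)
    (\<lambda>y. zero_on (set ds) y \<longleftrightarrow> \<alpha> y = 1)"
proof -
  let ?digit_test = "inv (spread ds) \<circ> diag (\<lambda>y. \<alpha> y ^ leading_ones ds y) \<circ> spread ds"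
  have \<alpha>_ds: "ignores (set ds) \<alpha>" and \<alpha>_us: "ignores (set us) \<alpha>"
    using \<alpha>(1) by (auto intro: ignores_subset)
  have "bij (unary ds us)"
    using implementable_bij implementable_unary[of "[]" ds us] assms(1,2) by auto
  then have "inv (prepare ds us) = inv (spread ds) \<circ> inv (unary ds us)"
    unfolding prepare_def by (intro o_inv_distrib bij_spread)
  moreover have "hoare (zero_on (set us)) (spread ds) (zero_on (set us))"
    by (intro hoare_spread ignores_zero_on) (use assms(1) in auto)
  ultimately have "register_test \<alpha> ds us \<psi> = ?digit_test \<psi>"
    if "supported (zero_on (set us)) \<psi>" for \<psi>
    using inv_unary_phase[OF assms(1,2) \<alpha>_us] that
    by (simp add: register_test_def prepare_def hoare_def)
  moreover have "supported (zero_on (set us)) \<psi>" "supported (zero_on (set ds)) \<psi>"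
    if "supported (zero_on (set ds \<union> set us)) \<psi>" for \<psi>
    using that by (auto elim!: supported_mono simp: zero_on_def)
  moreover have "hoare (zero_on (set ds)) ?digit_test (\<lambda>y. zero_on (set ds) y \<longleftrightarrow> \<alpha> y = 1)"
    using assms(1) by (intro hoare_digit_test \<alpha>_ds \<alpha>(2)) simp
  ultimately show ?thesis by (simp add: hoare_def)
qed

lemma hoare_register_test_frame:
  assumes "distinct (ds @ us)" "length us = length ds" "\<And>n. n < length ds \<Longrightarrow> rotation n \<in> S"
    and "ignores (set ds \<union> set us) P"
  shows "hoare P (register_test \<alpha> ds us) P"
proof -
  have prepare: "implementable (length ds + 1) (set ds \<union> set us) (set ds \<union> set us) (prepare ds us)"
    by (rule implementable_prepare) (use assms(1-3) in auto)
  show ?thesis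
    unfolding register_test_def
    by (intro hoare_comp[of P _ P] hoare_diag implementable_frame[OF prepare assms(4)]
        implementable_frame[OF implementable_inv[OF prepare] assms(4)])
qed

lemma hoare_copy_digit:
  assumes "distinct (k # ds @ us)" "length us = length ds" "\<And>n. n < length ds \<Longrightarrow> rotation n \<in> S"
    and "ignores (insert k (set ds \<union> set us)) \<alpha>" "\<And>y. \<alpha> y ^ (length ds + 1) = 1"
  shows "hoare (zero_on (insert k (set ds \<union> set us))) (or_gate ds k \<circ> register_test \<alpha> ds us)
    (\<lambda>y. y k \<longleftrightarrow> \<alpha> y \<noteq> 1)"
proof -
  let ?passed = "\<lambda>y. (zero_on (set ds) y \<longleftrightarrow> \<alpha> y = 1) \<and> \<not> y k"
  have "hoare (zero_on (set ds \<union> set us)) (register_test \<alpha> ds us)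
      (\<lambda>y. zero_on (set ds) y \<longleftrightarrow> \<alpha> y = 1)"
    using assms by (intro hoare_register_test) (auto intro: ignores_subset)
  moreover have "hoare (\<lambda>y. \<not> y k) (register_test \<alpha> ds us) (\<lambda>y. \<not> y k)"
    using assms(1-3)
    by (intro hoare_register_test_frame ignores_compose[OF ignores_line]) auto
  ultimately have "hoare (\<lambda>y. zero_on (set ds \<union> set us) y \<and> \<not> y k) (register_test \<alpha> ds us) ?passed"
    by (rule hoare_conj)
  moreover have "hoare ?passed (or_gate ds k) (\<lambda>y. y k \<longleftrightarrow> \<alpha> y \<noteq> 1)"
  proof (rule hoare_or_gate)
    have "\<alpha> (y(k := b)) = \<alpha> y" for y b by (rule ignores_fun_upd[OF assms(4)]) simp
    then show "(y(k := (y k \<noteq> (\<exists>d\<in>set ds. y d)))) k \<longleftrightarrow>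
        \<alpha> (y(k := (y k \<noteq> (\<exists>d\<in>set ds. y d)))) \<noteq> 1" if "?passed y" for y
      using that by (auto simp: zero_on_def)
  qed (use assms(1) in auto)
  ultimately have "hoare (\<lambda>y. zero_on (set ds \<union> set us) y \<and> \<not> y k)
      (or_gate ds k \<circ> register_test \<alpha> ds us) (\<lambda>y. y k \<longleftrightarrow> \<alpha> y \<noteq> 1)"
    by (rule hoare_comp)
  then show ?thesis by (rule hoare_mono) (auto simp: zero_on_def)
qed

end

section \<open>Phases\<close>

definition phase :: "complex \<Rightarrow> mat2" where
  "phase a c b = (if c = b then if b then a else 1 else 0)"

definition root_of_unity :: "nat \<Rightarrow> complex" where
  "root_of_unity n = cis (2 * pi / real n)"

lemma apply_phase: "apply_gate (OneQ (phase a) l) = diag (\<lambda>y. if y l then a else 1)"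
proof (intro ext)
  fix \<psi> y
  show "apply_gate (OneQ (phase a) l) \<psi> y = diag (\<lambda>y. if y l then a else 1) \<psi> y"
    by (cases "y l") (simp_all add: apply_gate_def phase_def diag_def UNIV_bool fun_upd_idem)
qed

lemma unitary2_phase: "cmod a = 1 \<Longrightarrow> unitary2 (phase a)"
  using complex_norm_square[of a]
  by (simp add: unitary2_def phase_def UNIV_bool all_bool_eq mult.commute)

lemma root_of_unity_power_eq_1_iff:
  assumes "n > 0"
  shows "root_of_unity n ^ k = 1 \<longleftrightarrow> n dvd k"
proof -
  have power: "root_of_unity n ^ j = cis (2 * pi * real j / real n)" for j
    by (simp add: root_of_unity_def DeMoivre mult_ac)
  have "root_of_unity n ^ n = 1" using assms by (simp add: power)
  then have "root_of_unity n ^ k = root_of_unity n ^ (k mod n)"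
    by (metis mult.commute mult_1 power_add power_mult power_one mod_mult_div_eq)
  moreover have "inj_on (\<lambda>j. root_of_unity n ^ j) {..<n}"
    using bij_betw_imp_inj_on[OF bij_betw_roots_unity[OF assms]] by (simp only: power)
  then have "root_of_unity n ^ (k mod n) = root_of_unity n ^ 0 \<longleftrightarrow> k mod n = 0"
    by (rule inj_on_eq_iff) (use assms in auto)
  ultimately show ?thesis by (simp add: dvd_eq_mod_eq_0)
qed

lemma prod_residue_test:
  assumes "n > 0"
  shows "(\<Prod>j<n. if n dvd s + j then root_of_unity n ^ (n - j) else 1) = root_of_unity n ^ s"
proof -
  define j\<^sub>0 where "j\<^sub>0 = (if s mod n = 0 then 0 else n - s mod n)"
  have j\<^sub>0: "j\<^sub>0 < n" using assms by (simp add: j\<^sub>0_def)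
  have dvd_iff: "n dvd s + j \<longleftrightarrow> j = j\<^sub>0" if "j < n" for j
  proof -
    have "n dvd s + j \<longleftrightarrow> (s mod n + j) mod n = 0"
      by (simp add: dvd_eq_mod_eq_0 mod_add_left_eq)
    moreover have "(s mod n + j) mod n = (if s mod n + j < n then s mod n + j else s mod n + j - n)"
      using that assms by (simp add: le_mod_geq less_diff_conv2 add_less_mono)
    ultimately show ?thesis
      using that mod_less_divisor[OF assms, of s] by (auto simp: j\<^sub>0_def split: if_splits)
  qed
  have "(\<Prod>j<n. if n dvd s + j then root_of_unity n ^ (n - j) else 1) =
      (\<Prod>j<n. if j = j\<^sub>0 then root_of_unity n ^ (n - j\<^sub>0) else 1)"
    by (intro prod.cong) (auto simp: dvd_iff)
  also have "\<dots> = root_of_unity n ^ (n - j\<^sub>0)" using j\<^sub>0 by simp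
  also have "\<dots> = root_of_unity n ^ s"
  proof -
    have "root_of_unity n ^ (s + j\<^sub>0) = 1" "root_of_unity n ^ (n - j\<^sub>0 + j\<^sub>0) = 1"
      using dvd_iff[OF j\<^sub>0] j\<^sub>0 assms by (simp_all only: root_of_unity_power_eq_1_iff) simp_all
    then have "root_of_unity n ^ (n - j\<^sub>0) * root_of_unity n ^ j\<^sub>0 =
        root_of_unity n ^ s * root_of_unity n ^ j\<^sub>0"
      by (simp only: power_add)
    moreover have "root_of_unity n \<noteq> 0" by (simp add: root_of_unity_def)
    ultimately show ?thesis by simp
  qed
  finally show ?thesis .
qed

lemma Modq_map_iff: "Modq q (map y ls) \<longleftrightarrow> \<not> q dvd weight ls y"
  by (simp add: Modq_def weight_def filter_map comp_def dvd_eq_mod_eq_0)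

lemma weight_append: "weight (ls @ ls') y = weight ls y + weight ls' y"
  by (simp add: weight_def)

lemma prod_list_weight: "(\<Prod>l\<leftarrow>ls. if y l then a else 1) = a ^ weight ls y" for a :: complex
  by (induction ls) (auto simp: weight_def)

context gate_basis
begin

lemma realizable_phase:
  assumes "phase a \<in> S" "l \<in> L" "l \<in> W" "\<And>y. P y \<Longrightarrow> y l \<longleftrightarrow> R y"
  shows "realizable 1 L W P (diag (\<lambda>y. if R y then a else 1))"
proof (rule realizable_cong)
  show "realizable 1 L W P (apply_gate (OneQ (phase a) l))"
    using assms(1-3)
    by (intro implementable_realizable implementable_gate) (simp add: gate_within_OneQ)
  show "apply_gate (OneQ (phase a) l) \<psi> = diag (\<lambda>y. if R y then a else 1) \<psi>"
    if "supported P \<psi>" for \<psi>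
    unfolding apply_phase using assms(4) by (intro diag_cong_supported[OF that]) simp
qed

text \<open>MOD gates only test for the residue 0, so the weight is shifted by \<open>j\<close> constant ones.\<close>

definition residue_test :: "nat \<Rightarrow> nat list \<Rightarrow> nat list \<Rightarrow> nat \<Rightarrow> nat \<Rightarrow> nat \<Rightarrow> vec \<Rightarrow> vec" where
  "residue_test c us os t e j =
     apply_gate (Toff [c, t] e) \<circ> (apply_gate (ModG q (us @ take j os) t) \<circ> negate (t # take j os))"

lemma implementable_residue_test:
  assumes "distinct (c # us @ os @ [t, e])"
  shows "implementable 3 (insert c (set us \<union> set os \<union> {t, e})) (set os \<union> {t, e})
    (residue_test c us os t e j)"
proof -
  let ?L = "insert c (set us \<union> set os \<union> {t, e})" and ?W = "set os \<union> {t, e}"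
  have ones: "set (take j os) \<subseteq> set os" by (rule set_take_subset)
  have "implementable 1 ?L ?W (negate (t # take j os))"
    by (rule implementable_mono[OF implementable_negate]) (use assms ones in auto)
  moreover have "gate_within ?L ?W (ModG q (us @ take j os) t)" "gate_within ?L ?W (Toff [c, t] e)"
    using assms ones by (auto simp: gate_within_ModG gate_within_Toff)
  ultimately have "implementable (1 + 1 + 1) ?L ?W (residue_test c us os t e j)"
    unfolding residue_test_def by (intro implementable_comp implementable_gate)
  then show ?thesis by (simp add: numeral_3_eq_3)
qed

lemma hoare_residue_test:
  assumes lines: "distinct (c # us @ os @ [t, e])" and j: "j \<le> length os"
  shows "hoare (zero_on (set os \<union> {t, e})) (residue_test c us os t e j)
    (\<lambda>y. y e \<longleftrightarrow> y c \<and> q dvd weight us y + j)"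
proof -
  let ?ones = "take j os"
  let ?mod = "ModG q (us @ ?ones) t" and ?and = "Toff [c, t] e"
  let ?P = "\<lambda>y. y t \<and> (\<forall>l\<in>set ?ones. y l) \<and> \<not> y e"
  let ?Q = "\<lambda>y. (y t \<longleftrightarrow> q dvd weight us y + j) \<and> \<not> y e"
  have ones: "set ?ones \<subseteq> set os" by (rule set_take_subset)
  have weight_upd: "weight us (y(l := b)) = weight us y" if "l \<in> {t, e}" for y l b
    by (rule ignores_fun_upd[OF ignores_weight[of _ "{t, e}"] that]) (use lines in auto)
  have "hoare (zero_on (set os \<union> {t, e})) (negate (t # ?ones)) ?P"
    by (rule hoare_negate) (use lines ones in \<open>auto simp: zero_on_def\<close>)
  moreover have "hoare ?P (apply_gate ?mod) ?Q"
  proof (rule hoare_classical)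
    fix y assume y: "?P y"
    then have "weight ?ones y = j" using j by (simp add: weight_def)
    then show "?Q (y(target ?mod := (y (target ?mod) \<noteq> toggles ?mod y)))"
      using y lines by (simp add: Modq_map_iff weight_append weight_upd del: map_append)
  qed (use lines ones in auto)
  moreover have "hoare ?Q (apply_gate ?and) (\<lambda>y. y e \<longleftrightarrow> y c \<and> q dvd weight us y + j)"
    by (rule hoare_classical) (use lines weight_upd in auto)
  ultimately show ?thesis
    unfolding residue_test_def by (intro hoare_comp)
qed

lemma realizable_residue_phase:
  assumes lines: "distinct (c # us @ os @ [t, e])" and "j \<le> length os" "phase a \<in> S"
  defines "L \<equiv> insert c (set us \<union> set os \<union> {t, e})" and "W \<equiv> set os \<union> {t, e}"
  shows "realizable 7 L W (zero_on W) (diag (\<lambda>y. if y c \<and> q dvd weight us y + j then a else 1))"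
proof -
  let ?R = "\<lambda>y. y c \<and> q dvd weight us y + j"
  let ?phase = "diag (\<lambda>y. if ?R y then a else 1)"
  note test = implementable_residue_test[OF lines, of j, folded L_def W_def]
  have "realizable 1 L W (\<lambda>y. y e \<longleftrightarrow> ?R y) ?phase"
    using assms(3) by (rule realizable_phase) (auto simp: L_def W_def)
  moreover have "ignores W (\<lambda>y. y c)" "ignores W (weight us)"
    using lines by (auto simp: W_def intro!: ignores_weight ignores_line)
  then have "ignores W (\<lambda>y. if ?R y then a else 1)"
    by (rule ignores_compose2)
  then have "residue_test c us os t e j \<circ> ?phase = ?phase \<circ> residue_test c us os t e j"
    using implementable_commute_diag[OF test] by auto
  ultimately have "realizable (2 * 3 + 1) L W (zero_on W) ?phase"
    using hoare_residue_test[OF assms(1,2), folded W_def] by (intro realizable_conjugate[OF test])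
  then show ?thesis by simp
qed

lemma realizable_weight_phase:
  assumes lines: "distinct (c # us @ os @ [t, e])" "length os = q" and q: "q > 0"
    and S: "\<And>j. j \<le> q \<Longrightarrow> phase (root_of_unity q ^ j) \<in> S"
  defines "L \<equiv> insert c (set us \<union> set os \<union> {t, e})" and "W \<equiv> set os \<union> {t, e}"
  shows "realizable (7 * q) L W (zero_on W)
    (diag (\<lambda>y. (if y c then root_of_unity q else 1) ^ weight us y))"
proof -
  let ?f = "\<lambda>j y. if y c \<and> q dvd weight us y + j then root_of_unity q ^ (q - j) else 1"
  have "realizable (length [0..<q] * 7) L W (zero_on W) (fold (\<lambda>j. diag (?f j)) [0..<q])"
  proof (rule realizable_fold, rule conjI)
    fix j assume "j \<in> set [0..<q]"
    then show "realizable 7 L W (zero_on W) (diag (?f j))"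
      unfolding L_def W_def using lines(2) S by (intro realizable_residue_phase lines(1)) auto
  qed (rule hoare_diag)
  moreover have "(\<Prod>j\<leftarrow>[0..<q]. ?f j y) = (if y c then root_of_unity q else 1) ^ weight us y" for y
    using prod_residue_test[OF q, of "weight us y"]
    by (simp add: prod.distinct_set_conv_list[symmetric] atLeast0LessThan)
  ultimately show ?thesis by (simp add: fold_diag mult.commute)
qed

end

section \<open>Fan-out\<close>

lemma fold_conjugate:
  assumes "distinct is"
    and "\<And>i j. i \<in> set is \<Longrightarrow> j \<in> set is \<Longrightarrow> i \<noteq> j \<Longrightarrow> Z i \<circ> A j = A j \<circ> Z i"
    and "\<And>i j. i \<in> set is \<Longrightarrow> j \<in> set is \<Longrightarrow> i \<noteq> j \<Longrightarrow> D i \<circ> A j = A j \<circ> D i"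
    and "\<And>i j. i \<in> set is \<Longrightarrow> j \<in> set is \<Longrightarrow> i \<noteq> j \<Longrightarrow> Z i \<circ> D j = D j \<circ> Z i"
  shows "fold Z is \<circ> fold D is \<circ> fold A is = fold (\<lambda>i. Z i \<circ> D i \<circ> A i) is"
  using assms
proof (induction "is")
  case (Cons i "is")
  have IH: "fold Z is \<circ> fold D is \<circ> fold A is = fold (\<lambda>i. Z i \<circ> D i \<circ> A i) is"
    by (rule Cons.IH) (use Cons.prems in auto)
  have ZA: "Z i \<circ> fold A is = fold A is \<circ> Z i"
    by (rule fold_commute, rule Cons.prems(2)) (use Cons.prems(1) in auto)
  have DA: "D i \<circ> fold A is = fold A is \<circ> D i"
    by (rule fold_commute, rule Cons.prems(3)) (use Cons.prems(1) in auto)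
  have ZD: "Z i \<circ> fold D is = fold D is \<circ> Z i"
    by (rule fold_commute, rule Cons.prems(4)) (use Cons.prems(1) in auto)
  have "fold Z (i # is) \<circ> fold D (i # is) \<circ> fold A (i # is) =
      fold Z is \<circ> (Z i \<circ> fold D is) \<circ> (D i \<circ> fold A is) \<circ> A i"
    by (simp add: comp_def)
  also have "\<dots> = fold Z is \<circ> fold D is \<circ> (Z i \<circ> fold A is) \<circ> D i \<circ> A i"
    unfolding ZD DA by (simp only: comp_assoc)
  also have "\<dots> = (fold Z is \<circ> fold D is \<circ> fold A is) \<circ> (Z i \<circ> D i \<circ> A i)"
    unfolding ZA by (simp only: comp_assoc)
  finally show ?case by (simp only: IH fold_Cons)
qed simp

lemma power_sum_list: "a ^ sum_list ns = (\<Prod>n\<leftarrow>ns. a ^ n)" for a :: complex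
  by (induction ns) (simp_all add: power_add)

lemma weight_concat: "weight (concat lss) y = (\<Sum>ls\<leftarrow>lss. weight ls y)"
  by (induction lss) (simp_all add: weight_def)

locale mod_gates = gate_basis +
  fixes p :: nat
  assumes q_ge: "q \<ge> 2" and p_ge: "p \<ge> 2"
    and rotation_in: "n < p + q \<Longrightarrow> rotation n \<in> S"
    and phase_q_in: "j \<le> q \<Longrightarrow> phase (root_of_unity q ^ j) \<in> S"
    and phase_p_in: "phase (root_of_unity p) \<in> S"
begin

definition fan_out_depth :: nat where
  "fan_out_depth = 9 * q + 3"

definition fan_phase_depth :: nat where
  "fan_phase_depth = 2 * (fan_out_depth + 1) + 1"

definition mod_test_depth :: nat where
  "mod_test_depth = 2 * p + (p - 1) * fan_phase_depth"

definition mod_depth :: nat where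
  "mod_depth = 2 * mod_test_depth + 3"

end

text \<open>Roles of the work lines: \<open>line r i j\<close> is the \<open>j\<close>-th line of role \<open>r\<close> in the \<open>i\<close>-th copy.\<close>

datatype role =
    Digit | Unary | Copy | Product | Padding | Test | Controlled_Test | Mod_Digit | Mod_Unary

locale work_lines = mod_gates +
  fixes m :: nat and line :: "role \<Rightarrow> nat \<Rightarrow> nat \<Rightarrow> nat"
  assumes line_eq_iff [simp]: "line r i j = line r' i' j' \<longleftrightarrow> r = r' \<and> i = i' \<and> j = j'"
begin

definition block :: "role set \<Rightarrow> nat set" where
  "block R = {line r i j | r i j. r \<in> R \<and> i \<le> m \<and> j < p + q}"

definition row :: "role \<Rightarrow> nat \<Rightarrow> nat \<Rightarrow> nat list" where
  "row r i n = map (line r i) [0..<n]"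

abbreviation digits :: "nat \<Rightarrow> nat list" where
  "digits i \<equiv> row Digit i (q - 1)"

abbreviation units :: "nat \<Rightarrow> nat list" where
  "units i \<equiv> row Unary i (q - 1)"

abbreviation copy :: "nat \<Rightarrow> nat" where
  "copy i \<equiv> line Copy i 0"

abbreviation register_block :: "nat set" where
  "register_block \<equiv> block {Digit, Unary, Copy}"

abbreviation test_block :: "nat set" where
  "test_block \<equiv> block {Padding, Test, Controlled_Test}"

abbreviation fan_block :: "nat set" where
  "fan_block \<equiv> block {Digit, Unary, Copy, Padding, Test, Controlled_Test}"

abbreviation phase_block :: "nat set" where
  "phase_block \<equiv> block {Digit, Unary, Copy, Padding, Test, Controlled_Test, Product}"

lemma line_in_block_iff [simp]: "line r i j \<in> block R \<longleftrightarrow> r \<in> R \<and> i \<le> m \<and> j < p + q"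
  by (auto simp: block_def)

lemma block_mono: "R \<subseteq> R' \<Longrightarrow> block R \<subseteq> block R'"
  by (auto simp: block_def)

lemma block_disjoint: "R \<inter> R' = {} \<Longrightarrow> block R \<inter> block R' = {}"
  by (auto simp: block_def)

lemma set_row: "set (row r i n) = line r i ` {..<n}"
  by (simp add: row_def atLeast0LessThan)

lemma distinct_row [simp]: "distinct (row r i n)"
  by (simp add: row_def distinct_map inj_on_def)

lemma length_row [simp]: "length (row r i n) = n"
  by (simp add: row_def)

lemma register_block_subset: "register_block \<subseteq> fan_block"
  and test_block_subset: "test_block \<subseteq> fan_block"
  by (rule block_mono; simp)+

definition copy_phase :: "nat \<Rightarrow> assignment \<Rightarrow> complex" where
  "copy_phase c y = (if y c then root_of_unity q else 1)"

definition register :: "nat \<Rightarrow> nat set" where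
  "register i = insert (copy i) (set (digits i) \<union> set (units i))"

definition copy_digit :: "nat \<Rightarrow> vec \<Rightarrow> vec" where
  "copy_digit i = or_gate (digits i) (copy i) \<circ> inv (prepare (digits i) (units i))"

lemma register_disjoint: "i \<noteq> j \<Longrightarrow> register i \<inter> register j = {}"
  by (auto simp: register_def set_row)

lemma register_subset: "i < m \<Longrightarrow> register i \<subseteq> register_block"
  using p_ge by (auto simp: register_def set_row)

lemma distinct_register: "distinct (copy i # digits i @ units i)"
  by (auto simp: set_row)

lemma implementable_prepare_register:
  "implementable q (register i) (register i) (prepare (digits i) (units i))"
proof -
  have "implementable (length (digits i) + 1) (set (digits i) \<union> set (units i))
      (set (digits i) \<union> set (units i)) (prepare (digits i) (units i))"
    by (rule implementable_prepare) (use distinct_register[of i] rotation_in in auto)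
  then show ?thesis
    by (rule implementable_mono) (use q_ge in \<open>auto simp: register_def\<close>)
qed

lemma implementable_copy_digit: "implementable (q + 3) (register i) (register i) (copy_digit i)"
  unfolding copy_digit_def
proof (intro implementable_comp implementable_inv implementable_prepare_register)
  show "implementable 3 (register i) (register i) (or_gate (digits i) (copy i))"
    by (rule implementable_mono[OF implementable_or_gate])
      (use distinct_register[of i] in \<open>auto simp: register_def\<close>)
qed

lemma implementable_registers:
  assumes "\<And>i. i < m \<Longrightarrow> implementable d (register i) (register i) (A i)"
  shows "implementable d register_block register_block (fold A [0..<m])"
proof -
  have "implementable d (\<Union>i\<in>set [0..<m]. register i) (\<Union>i\<in>set [0..<m]. register i) (fold A [0..<m])"
    using assms register_disjoint
    by (intro implementable_parallel sorted_wrt_if_distinct) (auto simp: disjnt_def)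
  then show ?thesis
    by (rule implementable_mono) (use register_subset in fastforce)+
qed

definition copy_register :: "nat \<Rightarrow> nat \<Rightarrow> vec \<Rightarrow> vec" where
  "copy_register c i =
     copy_digit i \<circ> diag (\<lambda>y. copy_phase c y ^ weight (units i) y) \<circ> prepare (digits i) (units i)"

lemma ignores_copy_phase: "c \<notin> W \<Longrightarrow> ignores W (copy_phase c)"
  unfolding copy_phase_def by (rule ignores_compose[OF ignores_line])

lemma hoare_copy_register:
  assumes "c \<notin> register i"
  shows "hoare (zero_on (register i)) (copy_register c i) (\<lambda>y. y (copy i) \<longleftrightarrow> y c)"
proof -
  have root: "root_of_unity q ^ q = 1" "root_of_unity q \<noteq> 1"
    using root_of_unity_power_eq_1_iff[of q q] root_of_unity_power_eq_1_iff[of q 1] q_ge by auto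
  have "hoare (zero_on (insert (copy i) (set (digits i) \<union> set (units i))))
      (or_gate (digits i) (copy i) \<circ> register_test (copy_phase c) (digits i) (units i))
      (\<lambda>y. y (copy i) \<longleftrightarrow> copy_phase c y \<noteq> 1)"
  proof (rule hoare_copy_digit)
    show "ignores (insert (copy i) (set (digits i) \<union> set (units i))) (copy_phase c)"
      using assms by (intro ignores_copy_phase) (simp add: register_def)
    show "copy_phase c y ^ (length (digits i) + 1) = 1" for y
      using q_ge root(1) by (simp add: copy_phase_def)
  qed (use distinct_register[of i] rotation_in in auto)
  moreover have "copy_phase c y \<noteq> 1 \<longleftrightarrow> y c" for y
    using root(2) by (simp add: copy_phase_def)
  ultimately show ?thesis
    by (simp only: copy_register_def copy_digit_def register_test_def register_def comp_assoc)
qed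

lemma hoare_copy_registers:
  assumes "c \<notin> register_block"
  shows "hoare (zero_on register_block) (fold (copy_register c) [0..<m])
    (\<lambda>y. \<forall>i<m. y (copy i) \<longleftrightarrow> y c)"
proof -
  have c: "c \<notin> register i" if "i < m" for i
    using assms register_subset[OF that] by blast
  have frame: "hoare P (copy_register c i) P" if "ignores (register i) P" for P i
    unfolding copy_register_def
    by (intro hoare_comp[of P _ P] hoare_diag
        implementable_frame[OF implementable_prepare_register that]
        implementable_frame[OF implementable_copy_digit that])
  have "hoare (\<lambda>y. \<forall>i\<in>set [0..<m]. zero_on (register i) y) (fold (copy_register c) [0..<m])
      (\<lambda>y. \<forall>i\<in>set [0..<m]. y (copy i) \<longleftrightarrow> y c)"
  proof (rule hoare_fold)
    fix i j assume ij: "i \<in> set [0..<m]" "j \<in> set [0..<m]" "i \<noteq> j"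
    then have disjoint: "register j \<inter> register i = {}" by (simp add: register_disjoint)
    then have "copy j \<notin> register i" by (auto simp: register_def)
    then have "ignores (register i) (\<lambda>y. y (copy j) \<longleftrightarrow> y c)"
      using c ij by (intro ignores_compose2[where h = "(=)"] ignores_line) auto
    then show "hoare (zero_on (register j)) (copy_register c i) (zero_on (register j)) \<and>
        hoare (\<lambda>y. y (copy j) \<longleftrightarrow> y c) (copy_register c i) (\<lambda>y. y (copy j) \<longleftrightarrow> y c)"
      using frame ignores_zero_on[OF disjoint] by blast
  qed (use hoare_copy_register[OF c] in simp_all)
  then show ?thesis
  proof (rule hoare_mono)
    show "\<forall>i\<in>set [0..<m]. zero_on (register i) y" if "zero_on register_block y" for y
      using zero_on_subset[OF that register_subset] by simp
  qed simp
qed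

lemma realizable_digit_sum_phase:
  assumes c: "c \<notin> fan_block"
  shows "realizable (7 * q) (insert c fan_block) fan_block (zero_on test_block)
    (diag (\<lambda>y. copy_phase c y ^ weight (concat (map units [0..<m])) y))"
proof -
  let ?us = "concat (map units [0..<m])" and ?os = "row Padding 0 q"
  let ?t = "line Test 0 0" and ?e = "line Controlled_Test 0 0"
  have us: "?us = map (\<lambda>z. line Unary (fst z) (snd z)) (List.product [0..<m] [0..<q - 1])"
    by (simp add: row_def product_concat_map map_concat comp_def)
  have lines: "set ?us \<subseteq> fan_block" "set ?os \<union> {?t, ?e} \<subseteq> test_block"
    using p_ge by (auto simp: us set_row)
  have "distinct ?us"
    unfolding us by (simp add: distinct_map distinct_product inj_on_def prod_eq_iff)
  then have "distinct (c # ?us @ ?os @ [?t, ?e])"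
    using c lines test_block_subset by (auto simp: us set_row)
  then have "realizable (7 * q) (insert c (set ?us \<union> set ?os \<union> {?t, ?e})) (set ?os \<union> {?t, ?e})
      (zero_on (set ?os \<union> {?t, ?e})) (diag (\<lambda>y. copy_phase c y ^ weight ?us y))"
    unfolding copy_phase_def by (rule realizable_weight_phase) (use q_ge phase_q_in in auto)
  then show ?thesis
    by (rule realizable_mono) (use lines test_block_subset in \<open>auto intro: zero_on_subset\<close>)
qed

lemma fold_copy_register:
  assumes "c \<notin> register_block"
  shows "fold copy_digit [0..<m] \<circ>
      diag (\<lambda>y. copy_phase c y ^ weight (concat (map units [0..<m])) y) \<circ>
      fold (\<lambda>i. prepare (digits i) (units i)) [0..<m] = fold (copy_register c) [0..<m]"
proof -
  let ?f = "\<lambda>i y. copy_phase c y ^ weight (units i) y"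
  have f: "ignores (register j) (?f i)" if "j \<in> set [0..<m]" "i \<noteq> j" for i j
  proof (rule ignores_compose2[OF ignores_copy_phase ignores_weight])
    show "c \<notin> register j" using assms that(1) register_subset by auto
    show "set (units i) \<inter> register j = {}"
      using register_disjoint[OF that(2)] by (auto simp: register_def)
  qed
  have "copy_phase c y ^ weight (concat (map units [0..<m])) y = (\<Prod>i\<leftarrow>[0..<m]. ?f i y)" for y
    by (simp only: weight_concat power_sum_list map_map comp_def)
  then have "diag (\<lambda>y. copy_phase c y ^ weight (concat (map units [0..<m])) y) =
      fold (\<lambda>i. diag (?f i)) [0..<m]"
    by (simp add: fold_diag)
  moreover have "fold copy_digit [0..<m] \<circ> fold (\<lambda>i. diag (?f i)) [0..<m] \<circ>
      fold (\<lambda>i. prepare (digits i) (units i)) [0..<m] = fold (copy_register c) [0..<m]"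
    unfolding copy_register_def
  proof (rule fold_conjugate)
    fix i j assume ij: "i \<in> set [0..<m]" "j \<in> set [0..<m]" "i \<noteq> j"
    show "copy_digit i \<circ> prepare (digits j) (units j) = prepare (digits j) (units j) \<circ> copy_digit i"
      by (rule implementable_commute[OF implementable_copy_digit implementable_prepare_register
            register_disjoint[OF ij(3)]])
    show "diag (?f i) \<circ> prepare (digits j) (units j) = prepare (digits j) (units j) \<circ> diag (?f i)"
      using implementable_commute_diag[OF implementable_prepare_register f[OF ij(2,3)]] by auto
    show "copy_digit i \<circ> diag (?f j) = diag (?f j) \<circ> copy_digit i"
      using implementable_commute_diag[OF implementable_copy_digit f[OF ij(1)]] ij(3) by auto
  qed simp
  ultimately show ?thesis by simp
qed

lemma fan_out:
  assumes c: "c \<notin> fan_block"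
  obtains B where "implementable fan_out_depth (insert c fan_block) fan_block B"
    and "hoare (zero_on fan_block) B (\<lambda>y. \<forall>i<m. y (copy i) \<longleftrightarrow> y c)"
proof -
  let ?prepare = "fold (\<lambda>i. prepare (digits i) (units i)) [0..<m]"
  let ?phase = "diag (\<lambda>y. copy_phase c y ^ weight (concat (map units [0..<m])) y)"
  let ?copy = "fold copy_digit [0..<m]"
  have c': "c \<notin> register_block" using c register_block_subset by blast
  obtain D where D: "implementable (7 * q) (insert c fan_block) fan_block D"
    "\<And>\<psi>. supported (zero_on test_block) \<psi> \<Longrightarrow> D \<psi> = ?phase \<psi>"
    using realizable_digit_sum_phase[OF c] unfolding realizable_def by blast
  have prepare: "implementable q register_block register_block ?prepare"
    by (rule implementable_registers) (rule implementable_prepare_register)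
  moreover have "implementable (q + 3) register_block register_block ?copy"
    by (rule implementable_registers) (rule implementable_copy_digit)
  ultimately have "implementable (q + 7 * q + (q + 3)) (insert c fan_block) fan_block
      (?copy \<circ> (D \<circ> ?prepare))"
    using register_block_subset by (intro implementable_comp D(1)) (auto elim!: implementable_mono)
  then have implementable:
    "implementable fan_out_depth (insert c fan_block) fan_block (?copy \<circ> (D \<circ> ?prepare))"
    by (simp add: fan_out_depth_def)
  have "(?copy \<circ> (D \<circ> ?prepare)) \<psi> = fold (copy_register c) [0..<m] \<psi>"
    if "supported (zero_on fan_block) \<psi>" for \<psi>
  proof -
    have "hoare (zero_on test_block) ?prepare (zero_on test_block)"
      by (intro implementable_frame[OF prepare] ignores_zero_on block_disjoint) auto
    moreover have "supported (zero_on test_block) \<psi>"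
      by (rule supported_mono[OF that]) (rule zero_on_subset[OF _ test_block_subset])
    ultimately have "D (?prepare \<psi>) = ?phase (?prepare \<psi>)" by (simp add: D(2) hoare_def)
    then show ?thesis unfolding fold_copy_register[OF c', symmetric] by simp
  qed
  moreover have "hoare (zero_on fan_block) (fold (copy_register c) [0..<m])
      (\<lambda>y. \<forall>i<m. y (copy i) \<longleftrightarrow> y c)"
    using hoare_copy_registers[OF c']
    by (rule hoare_mono) (rule zero_on_subset[OF _ register_block_subset])
  ultimately have "hoare (zero_on fan_block) (?copy \<circ> (D \<circ> ?prepare)) (\<lambda>y. \<forall>i<m. y (copy i) \<longleftrightarrow> y c)"
    by (simp add: hoare_def)
  then show thesis by (rule that[OF implementable])
qed

end

section \<open>The MOD gate of another modulus\<close>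

lemma or_gate_eq_ModG:
  assumes "supported (\<lambda>y. zero_on (set cs) y \<longleftrightarrow> r dvd weight xs y) \<psi>"
    and "distinct (t # cs)" "t \<notin> set xs"
  shows "or_gate cs t \<psi> = apply_gate (ModG r xs t) \<psi>"
proof
  fix y
  let ?P = "\<lambda>y. zero_on (set cs) y \<longleftrightarrow> r dvd weight xs y"
  have "ignores {t} (zero_on (set cs))" "ignores {t} (weight xs)"
    using assms(2,3) by (auto intro: ignores_zero_on ignores_weight)
  then have "?P (y(t := b)) = ?P y" for b
    by (simp add: ignores_fun_upd)
  then have "\<psi> (y(t := b)) = 0" if "\<not> ?P y" for b
    using that assms(1) unfolding supported_def by metis
  then show "or_gate cs t \<psi> y = apply_gate (ModG r xs t) \<psi> y"
    by (cases "?P y")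
      (auto simp: or_gate_apply[OF assms(2)] apply_classical Modq_map_iff zero_on_def)
qed

locale mod_inputs = work_lines +
  fixes xs :: "nat list"
  assumes distinct_inputs: "distinct xs" and length_inputs: "length xs = m"
    and line_notin_inputs: "line r i j \<notin> set xs"
begin

abbreviation product :: "nat \<Rightarrow> nat" where
  "product i \<equiv> line Product i 0"

definition products :: "vec \<Rightarrow> vec" where
  "products = fold (\<lambda>i. apply_gate (Toff [copy i, xs ! i] (product i))) [0..<m]"

lemma nth_input: "i < m \<Longrightarrow> xs ! i \<in> set xs"
  by (simp add: length_inputs)

lemma nth_input_neq_line: "i < m \<Longrightarrow> xs ! i \<noteq> line r k j" "i < m \<Longrightarrow> line r k j \<noteq> xs ! i"
  using nth_input line_notin_inputs by metis+

lemma inputs_disjoint_block: "set xs \<inter> block R = {}"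
  using line_notin_inputs by (auto simp: block_def)

lemma implementable_products: "implementable 1 (set xs \<union> phase_block) (block {Product}) products"
proof -
  let ?L = "\<lambda>i. {copy i, xs ! i, product i}"
  have "implementable 1 (\<Union>i\<in>set [0..<m]. ?L i) (\<Union>i\<in>set [0..<m]. {product i}) products"
    unfolding products_def
  proof (rule implementable_parallel)
    show "implementable 1 (?L i) {product i} (apply_gate (Toff [copy i, xs ! i] (product i)))"
      if "i \<in> set [0..<m]" for i
      using nth_input_neq_line that by (intro implementable_gate) (auto simp: gate_within_Toff)
    show "sorted_wrt (\<lambda>i j. disjnt (?L i) (?L j)) [0..<m]"
      using nth_input_neq_line distinct_inputs length_inputs
      by (intro sorted_wrt_if_distinct) (auto simp: disjnt_def nth_eq_iff_index_eq)
  qed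
  then show ?thesis
    by (rule implementable_mono) (use nth_input p_ge in auto)
qed

lemma hoare_products:
  assumes "c \<notin> block {Product}"
  shows "hoare (\<lambda>y. (\<forall>i<m. y (copy i) \<longleftrightarrow> y c) \<and> zero_on (block {Product}) y) products
    (\<lambda>y. \<forall>i<m. y (product i) \<longleftrightarrow> y c \<and> y (xs ! i))"
proof -
  let ?gate = "\<lambda>i. apply_gate (Toff [copy i, xs ! i] (product i))"
  let ?P = "\<lambda>i y. (y (copy i) \<longleftrightarrow> y c) \<and> \<not> y (product i)"
  let ?Q = "\<lambda>i y. y (product i) \<longleftrightarrow> y c \<and> y (xs ! i)"
  have neq: "c \<noteq> product i" "product i \<noteq> c" if "i < m" for i
    using assms that p_ge by auto
  have "hoare (\<lambda>y. \<forall>i\<in>set [0..<m]. ?P i y) products (\<lambda>y. \<forall>i\<in>set [0..<m]. ?Q i y)"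
    unfolding products_def
  proof (rule hoare_fold)
    show "hoare (?P i) (?gate i) (?Q i)" if "i \<in> set [0..<m]" for i
      using nth_input_neq_line neq that by (auto intro!: hoare_classical)
    show "hoare (?P j) (?gate i) (?P j) \<and> hoare (?Q j) (?gate i) (?Q j)"
      if "i \<in> set [0..<m]" "j \<in> set [0..<m]" "i \<noteq> j" for i j
      using nth_input_neq_line neq that by (auto intro!: hoare_classical)
  qed simp
  then show ?thesis
    by (rule hoare_mono) (use p_ge in \<open>auto simp: zero_on_def\<close>)
qed

lemma realizable_product_phase:
  "realizable 1 phase_block phase_block (\<lambda>y. \<forall>i<m. y (product i) \<longleftrightarrow> y c \<and> y (xs ! i))
    (diag (\<lambda>y. (if y c then root_of_unity p else 1) ^ weight xs y))"
proof -
  let ?f = "\<lambda>i y. if y c \<and> y (xs ! i) then root_of_unity p else 1"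
  have "realizable 1 (\<Union>i\<in>set [0..<m]. {product i}) (\<Union>i\<in>set [0..<m]. {product i})
      (\<lambda>y. \<forall>i<m. y (product i) \<longleftrightarrow> y c \<and> y (xs ! i)) (fold (\<lambda>i. diag (?f i)) [0..<m])"
    by (intro realizable_parallel conjI hoare_diag realizable_phase phase_p_in
        sorted_wrt_if_distinct)
      (auto simp: disjnt_def)
  moreover have "(\<Prod>i\<leftarrow>[0..<m]. ?f i y) = (if y c then root_of_unity p else 1) ^ weight xs y" for y
  proof -
    have "map (\<lambda>i. ?f i y) [0..<m] =
        map (\<lambda>x. if y x then if y c then root_of_unity p else 1 else 1) xs"
      using length_inputs by (intro nth_equalityI) auto
    then show ?thesis by (simp only: prod_list_weight)
  qed
  ultimately have "realizable 1 (\<Union>i\<in>set [0..<m]. {product i}) (\<Union>i\<in>set [0..<m]. {product i})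
      (\<lambda>y. \<forall>i<m. y (product i) \<longleftrightarrow> y c \<and> y (xs ! i))
      (diag (\<lambda>y. (if y c then root_of_unity p else 1) ^ weight xs y))"
    by (simp only: fold_diag)
  then show ?thesis by (rule realizable_mono) (use p_ge in auto)
qed

lemma realizable_fan_phase:
  assumes c: "c \<notin> phase_block"
  shows "realizable fan_phase_depth (insert c (set xs \<union> phase_block)) phase_block
    (zero_on phase_block) (diag (\<lambda>y. (if y c then root_of_unity p else 1) ^ weight xs y))"
proof -
  let ?L = "insert c (set xs \<union> phase_block)"
  let ?phase = "\<lambda>y. (if y c then root_of_unity p else 1) ^ weight xs y"
  have subset: "fan_block \<subseteq> phase_block" "block {Product} \<subseteq> phase_block"
    by (rule block_mono; simp)+
  obtain B where B: "implementable fan_out_depth (insert c fan_block) fan_block B"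
    "hoare (zero_on fan_block) B (\<lambda>y. \<forall>i<m. y (copy i) \<longleftrightarrow> y c)"
    using fan_out c subset(1) by blast
  have "implementable fan_out_depth ?L phase_block B" "implementable 1 ?L phase_block products"
    using subset
    by (auto intro: implementable_mono[OF B(1)] implementable_mono[OF implementable_products])
  then have A: "implementable (fan_out_depth + 1) ?L phase_block (products \<circ> B)"
    by (rule implementable_comp)
  have "hoare (zero_on (block {Product})) B (zero_on (block {Product}))"
    by (intro implementable_frame[OF B(1)] ignores_zero_on block_disjoint) simp
  with B(2) have "hoare (\<lambda>y. zero_on fan_block y \<and> zero_on (block {Product}) y) B
      (\<lambda>y. (\<forall>i<m. y (copy i) \<longleftrightarrow> y c) \<and> zero_on (block {Product}) y)"
    by (rule hoare_conj)
  moreover have "c \<notin> block {Product}" using c subset(2) by blast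
  ultimately have "hoare (\<lambda>y. zero_on fan_block y \<and> zero_on (block {Product}) y) (products \<circ> B)
      (\<lambda>y. \<forall>i<m. y (product i) \<longleftrightarrow> y c \<and> y (xs ! i))"
    using hoare_comp hoare_products by blast
  then have hoare: "hoare (zero_on phase_block) (products \<circ> B)
      (\<lambda>y. \<forall>i<m. y (product i) \<longleftrightarrow> y c \<and> y (xs ! i))"
    by (rule hoare_mono) (use subset zero_on_subset in blast)+
  have "ignores phase_block (\<lambda>y. if y c then root_of_unity p else 1)"
    by (rule ignores_compose[OF ignores_line[OF c]])
  then have "ignores phase_block ?phase"
    by (rule ignores_compose2[OF _ ignores_weight[OF inputs_disjoint_block]])
  then have commute: "products \<circ> B \<circ> diag ?phase = diag ?phase \<circ> (products \<circ> B)"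
    using implementable_commute_diag[OF A] by auto
  have "realizable 1 ?L phase_block (\<lambda>y. \<forall>i<m. y (product i) \<longleftrightarrow> y c \<and> y (xs ! i)) (diag ?phase)"
    by (rule realizable_mono[OF realizable_product_phase]) auto
  then show ?thesis
    unfolding fan_phase_depth_def by (rule realizable_conjugate[OF A hoare _ commute])
qed

abbreviation mod_digits :: "nat list" where
  "mod_digits \<equiv> row Mod_Digit 0 (p - 1)"

abbreviation mod_units :: "nat list" where
  "mod_units \<equiv> row Mod_Unary 0 (p - 1)"

lemma realizable_mod_phase:
  "realizable ((p - 1) * fan_phase_depth) (set xs \<union> block UNIV) (block UNIV) (zero_on phase_block)
    (diag (\<lambda>y. (root_of_unity p ^ weight xs y) ^ weight mod_units y))"
proof -
  let ?L = "set xs \<union> block UNIV"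
  let ?f = "\<lambda>u y. (if y u then root_of_unity p else 1) ^ weight xs y"
  have "realizable (length mod_units * fan_phase_depth) ?L (block UNIV) (zero_on phase_block)
      (fold (\<lambda>u. diag (?f u)) mod_units)"
  proof (intro realizable_fold conjI hoare_diag)
    fix u assume "u \<in> set mod_units"
    then obtain j where j: "u = line Mod_Unary 0 j" "j < p - 1" by (auto simp: set_row)
    then have "realizable fan_phase_depth (insert u (set xs \<union> phase_block)) phase_block
        (zero_on phase_block) (diag (?f u))"
      by (intro realizable_fan_phase) simp
    then show "realizable fan_phase_depth ?L (block UNIV) (zero_on phase_block) (diag (?f u))"
      by (rule realizable_mono) (use j block_mono[of _ UNIV] in auto)
  qed
  moreover have "?f u y = (if y u then root_of_unity p ^ weight xs y else 1)" for u y by simp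
  ultimately show ?thesis by (simp only: fold_diag prod_list_weight length_row)
qed

lemma distinct_mod_lines: "distinct (mod_digits @ mod_units)"
  by (auto simp: set_row)

lemma hoare_mod_register_test:
  "hoare (zero_on (block UNIV))
    (register_test (\<lambda>y. root_of_unity p ^ weight xs y) mod_digits mod_units)
    (\<lambda>y. zero_on (set mod_digits) y \<longleftrightarrow> p dvd weight xs y)"
proof -
  let ?\<alpha> = "\<lambda>y. root_of_unity p ^ weight xs y" and ?R = "set mod_digits \<union> set mod_units"
  have "hoare (zero_on ?R) (register_test ?\<alpha> mod_digits mod_units)
      (\<lambda>y. zero_on (set mod_digits) y \<longleftrightarrow> ?\<alpha> y = 1)"
  proof (rule hoare_register_test[OF distinct_mod_lines])
    show "ignores ?R ?\<alpha>"
      by (rule ignores_compose[OF ignores_weight]) (use line_notin_inputs in \<open>auto simp: set_row\<close>)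
    show "?\<alpha> y ^ (length mod_digits + 1) = 1" for y
      using p_ge by (simp add: root_of_unity_power_eq_1_iff flip: power_mult)
  qed simp
  moreover have "?R \<subseteq> block UNIV" by (auto simp: set_row)
  ultimately show ?thesis
    using p_ge by (elim hoare_mono)
      (auto simp: root_of_unity_power_eq_1_iff intro: zero_on_subset)
qed

lemma mod_test:
  obtains A where "implementable mod_test_depth (set xs \<union> block UNIV) (block UNIV) A"
    and "hoare (zero_on (block UNIV)) A (\<lambda>y. zero_on (set mod_digits) y \<longleftrightarrow> p dvd weight xs y)"
proof -
  let ?\<alpha> = "\<lambda>y. root_of_unity p ^ weight xs y"
  let ?L = "set xs \<union> block UNIV" and ?R = "set mod_digits \<union> set mod_units"
  let ?prepare = "prepare mod_digits mod_units"
  have R: "?R \<subseteq> block UNIV" "?R \<inter> phase_block = {}"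
    by (auto simp: set_row)
  have "implementable (length mod_digits + 1) ?R ?R ?prepare"
    by (rule implementable_prepare[OF distinct_mod_lines]) (use rotation_in in auto)
  then have prepare: "implementable p ?R ?R ?prepare"
    by (rule implementable_mono) (use p_ge in auto)
  obtain F where F: "implementable ((p - 1) * fan_phase_depth) ?L (block UNIV) F"
    "\<And>\<psi>. supported (zero_on phase_block) \<psi> \<Longrightarrow> F \<psi> = diag (\<lambda>y. ?\<alpha> y ^ weight mod_units y) \<psi>"
    using realizable_mod_phase unfolding realizable_def by blast
  let ?A = "inv ?prepare \<circ> (F \<circ> ?prepare)"
  have extend: "implementable p ?L (block UNIV) A" if "implementable p ?R ?R A" for A
    by (rule implementable_mono[OF that]) (use R in auto)
  have "implementable (p + (p - 1) * fan_phase_depth + p) ?L (block UNIV) ?A"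
    by (intro implementable_comp F(1) extend implementable_inv prepare)
  then have implementable: "implementable mod_test_depth ?L (block UNIV) ?A"
    by (simp add: mod_test_depth_def mult_2 add_ac)
  have "hoare (zero_on phase_block) ?prepare (zero_on phase_block)"
    by (rule implementable_frame[OF prepare ignores_zero_on]) (use R in auto)
  moreover have "supported (zero_on phase_block) \<psi>" if "supported (zero_on (block UNIV)) \<psi>" for \<psi>
    by (rule supported_mono[OF that]) (rule zero_on_subset[OF _ block_mono[OF subset_UNIV]])
  ultimately have "?A \<psi> = register_test ?\<alpha> mod_digits mod_units \<psi>"
    if "supported (zero_on (block UNIV)) \<psi>" for \<psi>
    using that F(2) by (simp add: register_test_def hoare_def)
  then have "hoare (zero_on (block UNIV)) ?A (\<lambda>y. zero_on (set mod_digits) y \<longleftrightarrow> p dvd weight xs y)"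
    using hoare_mod_register_test by (simp add: hoare_def)
  then show thesis by (rule that[OF implementable])
qed

lemma realizable_ModG:
  assumes t: "t \<notin> set xs" "t \<notin> block UNIV"
  shows "realizable mod_depth (insert t (set xs \<union> block UNIV)) (insert t (block UNIV))
    (zero_on (block UNIV)) (apply_gate (ModG p xs t))"
proof -
  let ?L = "set xs \<union> block UNIV"
  let ?tested = "\<lambda>y. zero_on (set mod_digits) y \<longleftrightarrow> p dvd weight xs y"
  obtain A where A: "implementable mod_test_depth ?L (block UNIV) A"
    and hoare: "hoare (zero_on (block UNIV)) A ?tested"
    by (rule mod_test)
  have digits: "distinct (t # mod_digits)" "set mod_digits \<subseteq> block UNIV"
    using t by (auto simp: set_row)
  have "realizable 3 (insert t ?L) (insert t (block UNIV)) ?tested (or_gate mod_digits t)"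
    using digits
    by (intro implementable_realizable implementable_mono[OF implementable_or_gate]) auto
  then have "realizable 3 (insert t ?L) (insert t (block UNIV)) ?tested (apply_gate (ModG p xs t))"
    by (rule realizable_cong) (rule or_gate_eq_ModG[OF _ digits(1) t(1)])
  moreover have "A \<circ> apply_gate (ModG p xs t) = apply_gate (ModG p xs t) \<circ> A"
    using t inputs_disjoint_block[of UNIV] by (intro implementable_commute_gate[OF A]) auto
  moreover have "implementable mod_test_depth (insert t ?L) (insert t (block UNIV)) A"
    by (rule implementable_mono[OF A]) auto
  ultimately show ?thesis
    unfolding mod_depth_def using hoare by (intro realizable_conjugate)
qed

end

section \<open>Simulation of circuits\<close>

lemma ex_inj_less_card:
  assumes "finite X"
  shows "\<exists>f :: 'a :: countable \<Rightarrow> nat. inj f \<and> (\<forall>x\<in>X. f x < card X)"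
proof -
  obtain h where h: "bij_betw h X {0..<card X}"
    using ex_bij_betw_finite_nat[OF assms] by blast
  let ?f = "\<lambda>x. if x \<in> X then h x else card X + to_nat x"
  have less: "h x < card X" if "x \<in> X" for x
    using bij_betw_apply[OF h that] by simp
  have "inj ?f"
  proof (rule injI)
    fix x y assume "?f x = ?f y"
    then show "x = y"
      using less[of x] less[of y] inj_onD[OF bij_betw_imp_inj_on[OF h], of x y]
      by (auto split: if_splits)
  qed
  then show ?thesis using less by (intro exI[of _ ?f]) simp
qed

instance role :: countable
  by countable_datatype

lemma finite_role: "finite (UNIV :: role set)"
proof (rule finite_subset)
  show "(UNIV :: role set) \<subseteq>
      {Digit, Unary, Copy, Product, Padding, Test, Controlled_Test, Mod_Digit, Mod_Unary}"
    using role.exhaust by auto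
qed simp

text \<open>Every line \<open>t\<close> owns a block of work lines, used by the gate with target \<open>t\<close>; hence the
  gates of a layer do not interfere.\<close>

definition slots :: "nat \<Rightarrow> nat \<Rightarrow> (role \<times> nat \<times> nat) set" where
  "slots c N = UNIV \<times> {..N} \<times> {..<c}"

definition slot_index :: "nat \<Rightarrow> nat \<Rightarrow> role \<times> nat \<times> nat \<Rightarrow> nat" where
  "slot_index c N = (SOME f. inj f \<and> (\<forall>x\<in>slots c N. f x < card (slots c N)))"

definition work_line :: "nat \<Rightarrow> nat \<Rightarrow> nat \<Rightarrow> role \<Rightarrow> nat \<Rightarrow> nat \<Rightarrow> nat" where
  "work_line c N t r i j = N + t * card (slots c N) + slot_index c N (r, i, j)"

definition work_block :: "nat \<Rightarrow> nat \<Rightarrow> nat \<Rightarrow> nat set" where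
  "work_block c N t = {N + t * card (slots c N)..<N + (t + 1) * card (slots c N)}"

definition gate_lines :: "nat \<Rightarrow> nat \<Rightarrow> gate \<Rightarrow> nat set" where
  "gate_lines c N g = set (glines g) \<union> work_block c N (target g)"

lemma slot_index: "inj (slot_index c N) \<and> (\<forall>x\<in>slots c N. slot_index c N x < card (slots c N))"
proof -
  have "finite (slots c N)" by (simp add: slots_def finite_role)
  from ex_inj_less_card[OF this] show ?thesis
    unfolding slot_index_def by (rule someI_ex)
qed

lemma work_line_eq_iff:
  "work_line c N t r i j = work_line c N t r' i' j' \<longleftrightarrow> r = r' \<and> i = i' \<and> j = j'"
  using slot_index[of c N] by (auto simp: work_line_def dest: injD)

lemma work_line_ge: "N \<le> work_line c N t r i j"
  by (simp add: work_line_def)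

lemma work_line_in_work_block: "i \<le> N \<Longrightarrow> j < c \<Longrightarrow> work_line c N t r i j \<in> work_block c N t"
  using slot_index[of c N] by (simp add: work_line_def work_block_def slots_def)

lemma work_block_subset: "t < N \<Longrightarrow> work_block c N t \<subseteq> {N..<N + N * card (slots c N)}"
  using mult_le_mono1[of "Suc t" N "card (slots c N)"] by (auto simp: work_block_def)

lemma work_block_disjoint:
  assumes "t \<noteq> t'"
  shows "work_block c N t \<inter> work_block c N t' = {}"
proof -
  have "work_block c N t \<inter> work_block c N t' = {}" if "t < t'" for t t'
    using mult_le_mono1[of "Suc t" t' "card (slots c N)"] that by (auto simp: work_block_def)
  then show ?thesis using assms by (metis Int_commute nat_neq_iff)
qed

lemma gate_lines_subset:
  "target g < N \<Longrightarrow> set (glines g) \<subseteq> {..<N} \<Longrightarrow> gate_lines c N g \<subseteq> {..<N + N * card (slots c N)}"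
  using work_block_subset[of "target g" N c] by (fastforce simp: gate_lines_def)

lemma gate_lines_disjoint:
  assumes "set (glines g) \<subseteq> {..<N}" "set (glines h) \<subseteq> {..<N}" "target g \<noteq> target h"
    and "disjnt (set (glines g)) (set (glines h))"
  shows "disjnt (gate_lines c N g) (gate_lines c N h)"
proof -
  have "set (glines f) \<inter> work_block c N t = {}" if "set (glines f) \<subseteq> {..<N}" for f t
    using that by (auto simp: work_block_def)
  then show ?thesis
    using assms work_block_disjoint[OF assms(3), of c N]
    by (simp add: gate_lines_def disjnt_def Int_Un_distrib Int_Un_distrib2 Int_commute)
qed

context mod_gates
begin

lemma gate_simulation:
  assumes g: "gate_wf (\<lambda>_. 0) N g" "qaccq_gate p g" "\<And>U i. g = OneQ U i \<Longrightarrow> U \<in> S"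
  shows "realizable mod_depth (gate_lines (p + q) N g) UNIV (zero_on {N..}) (apply_gate g)"
proof (cases "\<exists>ys t. g = ModG p ys t")
  case True
  then obtain ys t where g_eq: "g = ModG p ys t" by blast
  have wf: "distinct ys" "t \<notin> set ys" "\<forall>i\<in>set ys. i < N" "t < N"
    using g(1) by (auto simp: g_eq gate_wf_def)
  interpret mod_inputs q S p "length ys" "work_line (p + q) N t" ys
    by unfold_locales (use wf work_line_ge in \<open>auto simp: work_line_eq_iff not_less[symmetric]\<close>)
  have "card (set ys) \<le> card {..<N}" using wf by (intro card_mono) auto
  then have "length ys \<le> N" using wf(1) by (simp add: distinct_card)
  then have block: "block UNIV \<subseteq> work_block (p + q) N t" "block UNIV \<subseteq> {N..}"
    by (auto simp: block_def work_line_ge intro!: work_line_in_work_block)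
  have "t \<notin> block UNIV" using block(2) wf(4) by auto
  with wf(2) have "realizable mod_depth (insert t (set ys \<union> block UNIV)) (insert t (block UNIV))
      (zero_on (block UNIV)) (apply_gate g)"
    unfolding g_eq by (rule realizable_ModG)
  then show ?thesis
    by (rule realizable_mono)
      (use block in \<open>auto simp: gate_lines_def g_eq intro: zero_on_subset\<close>)
next
  case False
  then have "qac0_gate g" using g(2) by (simp add: qaccq_gate_def)
  then have "gate_within (gate_lines (p + q) N g) UNIV g"
    using g by (auto simp: gate_within_def gate_wf_def qaccq_gate_def gate_lines_def)
  then show ?thesis
    by (intro implementable_realizable implementable_mono[OF implementable_gate])
      (auto simp: mod_depth_def)
qed

lemma layer_simulation:
  assumes wf: "layer_wf (\<lambda>_. 0) N L"
    and gates: "\<And>g. g \<in> set (layer_gates L) \<Longrightarrow> qaccq_gate p g \<and> (\<forall>U i. g = OneQ U i \<longrightarrow> U \<in> S)"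
  shows "realizable mod_depth {..<N + N * card (slots (p + q) N)} UNIV (zero_on {N..})
    (apply_gates (layer_gates L))"
proof -
  have wf_gates: "disjoint_gates (layer_gates L)"
    "\<And>g. g \<in> set (layer_gates L) \<Longrightarrow> gate_wf (\<lambda>_. 0) N g"
    using wf by (auto simp: layer_wf_iff)
  have lines: "target g \<in> set (glines g)" "set (glines g) \<subseteq> {..<N}" "target g < N"
    if "g \<in> set (layer_gates L)" for g
    using target_in_glines[of g] qaccq_gate_not_oracle gates[OF that] wf_gates(2)[OF that]
    by (auto simp: gate_wf_def)
  have "realizable mod_depth (\<Union>g\<in>set (layer_gates L). gate_lines (p + q) N g)
      (\<Union>g\<in>set (layer_gates L). UNIV) (zero_on {N..}) (apply_gates (layer_gates L))"
  proof (rule realizable_parallel, rule conjI)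
    fix g assume g: "g \<in> set (layer_gates L)"
    show "realizable mod_depth (gate_lines (p + q) N g) UNIV (zero_on {N..}) (apply_gate g)"
      using gate_simulation wf_gates(2) gates g by blast
    show "hoare (zero_on {N..}) (apply_gate g) (zero_on {N..})"
      using hoare_zero_above[of "[g]" N] lines(3)[OF g] by simp
  next
    have "disjnt (gate_lines (p + q) N g) (gate_lines (p + q) N h)"
      if "g \<in> set (layer_gates L)" "h \<in> set (layer_gates L)"
        "disjnt (set (glines g)) (set (glines h))" for g h
      using lines[OF that(1)] lines[OF that(2)] that(3)
      by (intro gate_lines_disjoint) (auto simp: disjnt_def)
    then show "sorted_wrt (\<lambda>g h. disjnt (gate_lines (p + q) N g) (gate_lines (p + q) N h))
        (layer_gates L)"
      using wf_gates(1) unfolding disjoint_gates_def by (rule sorted_wrt_mono_rel)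
  qed
  then show ?thesis
    by (rule realizable_mono) (use gate_lines_subset lines in blast)+
qed

lemma circuit_simulation:
  assumes "circ_ok (qaccq_gate p) (\<lambda>_. 0) N d S C"
  shows "realizable (d * mod_depth) {..<N + N * card (slots (p + q) N)} UNIV (zero_on {N..})
    (run_circuit C)"
proof -
  let ?M = "{..<N + N * card (slots (p + q) N)}"
  have "realizable mod_depth ?M UNIV (zero_on {N..}) (apply_gates (layer_gates L)) \<and>
      hoare (zero_on {N..}) (apply_gates (layer_gates L)) (zero_on {N..})" if "L \<in> set C" for L
  proof -
    have L: "layer_wf (\<lambda>_. 0) N L"
      "\<And>g. g \<in> set (layer_gates L) \<Longrightarrow> qaccq_gate p g \<and> (\<forall>U i. g = OneQ U i \<longrightarrow> U \<in> S)"
      using assms that by (auto simp: circ_ok_def)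
    then show ?thesis
      using layer_simulation[OF L] hoare_layer_gates qaccq_gate_not_oracle by blast
  qed
  then have "realizable (length C * mod_depth) ?M UNIV (zero_on {N..}) (run_circuit C)"
    unfolding run_circuit_def by (rule realizable_fold)
  then show ?thesis
    by (rule realizable_mono) (use assms in \<open>auto simp: circ_ok_def\<close>)
qed

end

lemma (in gate_basis) realizable_circuit:
  assumes "realizable d {..<N} UNIV P A"
  shows "\<exists>C. circ_ok (qaccq_gate q) (\<lambda>_. 0) N d S C \<and> (\<forall>\<psi>. supported P \<psi> \<longrightarrow> run_circuit C \<psi> = A \<psi>)"
proof -
  obtain C where C: "circuit_within {..<N} UNIV C" "length C = d"
    "\<And>\<psi>. supported P \<psi> \<Longrightarrow> apply_gates (concat C) \<psi> = A \<psi>"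
    using assms unfolding realizable_def implementable_def by blast
  have "run_circuit (map GLayer C) = apply_gates (concat C)"
    unfolding run_circuit_def by (induction C) auto
  moreover have "gate_wf (\<lambda>_. 0) N g \<and> qaccq_gate q g \<and> (\<forall>U i. g = OneQ U i \<longrightarrow> U \<in> S)"
    if "gate_within {..<N} UNIV g" for g
    using that
    by (cases g) (auto simp: gate_within_def gate_wf_def qaccq_gate_def qac0_gate_def unitary)
  then have "circ_ok (qaccq_gate q) (\<lambda>_. 0) N d S (map GLayer C)"
    using C(1,2) by (simp add: circ_ok_def layer_wf_iff circuit_within_def) blast
  ultimately show ?thesis using C(3) by auto
qed

lemma ex_mod_gates:
  assumes "p \<ge> 2" "q \<ge> 2" "finite T" "\<And>U. U \<in> T \<Longrightarrow> unitary2 U"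
  obtains S where "finite S" "T \<subseteq> S" "mod_gates q S p"
proof -
  let ?B = "T \<union> rotation ` {..<p + q} \<union> (\<lambda>j. phase (root_of_unity q ^ j)) ` {..q} \<union>
    {phase (root_of_unity p)}"
  let ?S = "?B \<union> adjoint ` ?B"
  have "unitary2 (phase (root_of_unity n ^ j))" for n j
    by (rule unitary2_phase) (simp add: root_of_unity_def norm_power)
  from this this[of _ 1] have "\<forall>U\<in>?B. unitary2 U"
    using assms(4) unitary2_rotation by auto
  then have unitary: "\<forall>U\<in>?S. unitary2 U" using unitary2_adjoint by blast
  have "mod_gates q ?S p"
  proof
    show "adjoint U \<in> ?S" if "U \<in> ?S" for U
      using that
      by (elim UnE[of _ ?B] imageE[of _ adjoint]) (simp_all only: adjoint_adjoint UnI1 UnI2 imageI)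
    show "rotation n \<in> ?S" if "n < p + q" for n using that by blast
    show "phase (root_of_unity q ^ j) \<in> ?S" if "j \<le> q" for j using that by blast
  qed (use assms(1,2) unitary in blast)+
  then show thesis using assms(3) by (intro that[of ?S]) auto
qed

section \<open>Families and reducibility\<close>

lemma poly_bounded_iff: "poly_bounded a \<longleftrightarrow> (\<exists>c k. \<forall>n. a n \<le> c * (n + 1) ^ k)"
proof
  assume "poly_bounded a"
  then obtain c k where a: "\<And>n. a n \<le> c * n ^ k + c" by (auto simp: poly_bounded_def)
  have "a n \<le> (2 * c) * (n + 1) ^ k" for n
  proof -
    have "c * n ^ k \<le> c * (n + 1) ^ k" "c * 1 \<le> c * (n + 1) ^ k"
      by (intro mult_left_mono power_mono; simp)+
    then show ?thesis using a[of n] by linarith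
  qed
  then show "\<exists>c k. \<forall>n. a n \<le> c * (n + 1) ^ k" by blast
next
  assume "\<exists>c k. \<forall>n. a n \<le> c * (n + 1) ^ k"
  then obtain c k where a: "\<And>n. a n \<le> c * (n + 1) ^ k" by auto
  have "(n + 1) ^ k \<le> 2 ^ k * n ^ k + 2 ^ k" for n :: nat
  proof (cases n)
    case (Suc l)
    then have "(n + 1) ^ k \<le> (2 * n) ^ k" by (intro power_mono) auto
    then show ?thesis by (simp add: power_mult_distrib)
  qed (simp add: trans_le_add2)
  then have "c * (n + 1) ^ k \<le> (c * 2 ^ k) * n ^ k + c * 2 ^ k" for n
    using mult_le_mono2[of "(n + 1) ^ k" "2 ^ k * n ^ k + 2 ^ k" c] by (simp add: algebra_simps)
  then show "poly_bounded a" unfolding poly_bounded_def using a order_trans by blast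
qed

lemma poly_bounded_const: "poly_bounded (\<lambda>_. c)"
  unfolding poly_bounded_iff by (intro exI[of _ c] exI[of _ 0]) simp

lemma poly_bounded_id: "poly_bounded (\<lambda>n. n)"
  unfolding poly_bounded_iff by (intro exI[of _ 1]) simp

lemma poly_bounded_mult:
  assumes "poly_bounded a" "poly_bounded b"
  shows "poly_bounded (\<lambda>n. a n * b n)"
proof -
  obtain c k d l where a: "\<And>n. a n \<le> c * (n + 1) ^ k" and b: "\<And>n. b n \<le> d * (n + 1) ^ l"
    using assms unfolding poly_bounded_iff by blast
  have "a n * b n \<le> (c * d) * (n + 1) ^ (k + l)" for n
    using mult_mono[OF a[of n] b[of n]] by (simp add: power_add mult_ac)
  then show ?thesis unfolding poly_bounded_iff by blast
qed

lemma poly_bounded_add: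
  assumes "poly_bounded a" "poly_bounded b"
  shows "poly_bounded (\<lambda>n. a n + b n)"
proof -
  obtain c k d l where a: "\<And>n. a n \<le> c * (n + 1) ^ k" and b: "\<And>n. b n \<le> d * (n + 1) ^ l"
    using assms unfolding poly_bounded_iff by blast
  have "a n + b n \<le> (c + d) * (n + 1) ^ (k + l)" for n
  proof -
    have "c * (n + 1) ^ k \<le> c * (n + 1) ^ (k + l)" "d * (n + 1) ^ l \<le> d * (n + 1) ^ (k + l)"
      by (intro mult_left_mono power_increasing; simp)+
    then show ?thesis using a[of n] b[of n] unfolding distrib_right by linarith
  qed
  then show ?thesis unfolding poly_bounded_iff by blast
qed

lemma poly_bounded_card_slots: "poly_bounded w \<Longrightarrow> poly_bounded (\<lambda>n. card (slots c (w n)))"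
  unfolding slots_def card_cartesian_product card_atMost card_lessThan Suc_eq_plus1
  by (intro poly_bounded_mult poly_bounded_add poly_bounded_const)

lemma circ_mat_oracle:
  assumes "y \<in> states N" "x \<in> states N"
  shows "circ_mat G N [GLayer [Orc n [0..<N]]] y x = G n y x"
proof -
  have map_nth_states: "map ((!) z) [0..<N] = z" if "z \<in> states N" for z
    using that map_nth[of z] by (simp add: states_def)
  have "circ_mat G N [GLayer [Orc n [0..<N]]] y x = (\<Sum>z\<in>states N. if z = y then G n y x else 0)"
    unfolding circ_mat.simps op_mult_def
    by (intro sum.cong) (auto simp: op_id_def layer_mat_def map_nth_states assms)
  then show ?thesis using assms finite_states by simp
qed

lemma qac0_reducible_if_extends:
  assumes "poly_bounded k" "\<And>n. wG n = wF n + k n" "\<And>n. z n \<in> states (k n)"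
    and "\<And>n x y. x \<in> states (wF n) \<Longrightarrow> y \<in> states (wF n) \<Longrightarrow> F n y x = G n (y @ z n) (x @ z n)"
  shows "qac0_reducible wF F wG G"
  unfolding qac0_reducible_def
proof (intro exI[of _ k] exI[of _ 1] exI[of _ "{}"] conjI allI assms(1))
  fix n
  let ?C = "[GLayer [Orc n [0..<wF n + k n]]]"
  have "circ_ok (\<lambda>g. qac0_gate g \<or> (\<exists>m ls. g = Orc m ls)) wG (wF n + k n) 1 {} ?C"
    using assms(2) by (auto simp: circ_ok_def layer_wf_def gate_wf_def)
  moreover have "F n y x = circ_mat G (wF n + k n) ?C (y @ z n) (x @ z n)"
    if "x \<in> states (wF n)" "y \<in> states (wF n)" for x y
    using assms(3)[of n] that by (subst circ_mat_oracle) (auto simp: states_def assms(4))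
  ultimately show "\<exists>C. circ_ok (\<lambda>g. qac0_gate g \<or> (\<exists>m ls. g = Orc m ls)) wG (wF n + k n) 1 {} C \<and>
      (\<forall>x\<in>states (wF n). \<forall>y\<in>states (wF n). \<exists>z\<in>states (k n).
        F n y x = circ_mat G (wF n + k n) C (y @ z) (x @ z))"
    using assms(3)[of n] by blast
qed simp

lemma circ_mat_append_zeros:
  assumes C: "circ_ok (qaccq_gate p) (\<lambda>_. 0) N d S C"
    and D: "circ_ok (qaccq_gate q) (\<lambda>_. 0) (N + k) e T D"
    and eq: "\<And>\<psi>. supported (zero_on {N..}) \<psi> \<Longrightarrow> run_circuit D \<psi> = run_circuit C \<psi>"
    and xy: "x \<in> states N" "y \<in> states N"
  shows "circ_mat G (N + k) D (y @ replicate k False) (x @ replicate k False) = circ_mat G' N C y x"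
proof -
  have no_oracle: "layer_wf (\<lambda>_. 0) M L \<and> (\<forall>g\<in>set (layer_gates L). \<not> is_oracle g)"
    if "circ_ok (qaccq_gate r) (\<lambda>_. 0) M f R B" "L \<in> set B" for r M f R B L
    using that qaccq_gate_not_oracle by (auto simp: circ_ok_def)
  have assign_append: "assign (z @ replicate k False) = assign z" for z
    by (auto simp: assign_def fun_eq_iff nth_append)
  have "supported (zero_on {N..}) (basis_vec (assign x))"
    by (intro supported_basis_vec zero_on_assign xy(1))
  then show ?thesis
    using circ_mat_eq_amplitude[OF no_oracle[OF C] xy]
      circ_mat_eq_amplitude[OF no_oracle[OF D],
        where x = "x @ replicate k False" and y = "y @ replicate k False"] xy
    by (simp add: eq assign_append states_def)
qed

lemma (in mod_gates) circuit_simulation_zeros: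
  assumes "circ_ok (qaccq_gate p) (\<lambda>_. 0) N d S C" and k: "k = N * card (slots (p + q) N)"
  shows "\<exists>D. circ_ok (qaccq_gate q) (\<lambda>_. 0) (N + k) (d * mod_depth) S D \<and>
    (\<forall>x\<in>states N. \<forall>y\<in>states N. circ_mat G' N C y x =
      circ_mat G (N + k) D (y @ replicate k False) (x @ replicate k False))"
proof -
  obtain D where D: "circ_ok (qaccq_gate q) (\<lambda>_. 0) (N + k) (d * mod_depth) S D"
    "\<And>\<psi>. supported (zero_on {N..}) \<psi> \<Longrightarrow> run_circuit D \<psi> = run_circuit C \<psi>"
    using realizable_circuit[OF circuit_simulation[OF assms(1)]] unfolding k by blast
  show ?thesis
    using D circ_mat_append_zeros[OF assms(1) D] by metis
qed

lemma QACCq_simulation: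
  assumes pq: "p \<ge> 2" "q \<ge> 2" and F: "QACCq p w F"
  shows "\<exists>w' G. QACCq q w' G \<and> qac0_reducible w F w' G"
proof -
  let ?c = "\<lambda>N. circ_mat (\<lambda>_ _ _. 0) N"
  obtain a d U where a: "poly_bounded a" and U: "finite U" and w: "\<And>n. w n = n + a n"
    and C: "\<And>n. \<exists>C. circ_ok (qaccq_gate p) (\<lambda>_. 0) (w n) d U C \<and>
      (\<forall>x\<in>states (w n). \<forall>y\<in>states (w n). F n y x = ?c (w n) C y x)"
    using F unfolding QACCq_def circ_class_def by blast
  \<comment> \<open>\<open>U\<close> may contain matrices that are not unitary; the circuits do not use them.\<close>
  obtain S where S: "finite S" "{V \<in> U. unitary2 V} \<subseteq> S" "mod_gates q S p"
    by (rule ex_mod_gates[of p q "{V \<in> U. unitary2 V}"]) (use pq U in auto)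
  interpret mod_gates q S p by (rule S(3))
  define k where "k n = w n * card (slots (p + q) (w n))" for n
  have "\<exists>D. circ_ok (qaccq_gate q) (\<lambda>_. 0) (w n + k n) (d * mod_depth) S D \<and>
      (\<forall>x\<in>states (w n). \<forall>y\<in>states (w n).
        F n y x = ?c (w n + k n) D (y @ replicate (k n) False) (x @ replicate (k n) False))" for n
  proof -
    obtain C where C: "circ_ok (qaccq_gate p) (\<lambda>_. 0) (w n) d U C"
      "\<forall>x\<in>states (w n). \<forall>y\<in>states (w n). F n y x = ?c (w n) C y x"
      using C by blast
    have "circ_ok (qaccq_gate p) (\<lambda>_. 0) (w n) d S C"
      using C(1) S(2) by (fastforce simp: circ_ok_def layer_wf_iff gate_wf_def)
    from circuit_simulation_zeros[OF this k_def] show ?thesis using C(2) by simp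
  qed
  then obtain D where D: "\<And>n. circ_ok (qaccq_gate q) (\<lambda>_. 0) (w n + k n) (d * mod_depth) S (D n)"
    and FD: "\<And>n x y. x \<in> states (w n) \<Longrightarrow> y \<in> states (w n) \<Longrightarrow>
      F n y x = ?c (w n + k n) (D n) (y @ replicate (k n) False) (x @ replicate (k n) False)"
    by metis
  have k: "poly_bounded k"
    unfolding k_def w
    by (intro poly_bounded_mult poly_bounded_card_slots poly_bounded_add poly_bounded_id a)
  have "QACCq q (\<lambda>n. w n + k n) (\<lambda>n. ?c (w n + k n) (D n))"
    unfolding QACCq_def circ_class_def using D S(1) poly_bounded_add[OF a k]
    by (intro exI[of _ "\<lambda>n. a n + k n"] exI[of _ "d * mod_depth"] exI[of _ S]) (auto simp: w)
  moreover have "qac0_reducible w F (\<lambda>n. w n + k n) (\<lambda>n. ?c (w n + k n) (D n))"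
    by (rule qac0_reducible_if_extends[OF k, where z = "\<lambda>n. replicate (k n) False"])
      (simp_all add: FD states_def)
  ultimately show ?thesis by blast
qed

theorem mainTheorem7:
  fixes q :: nat
  assumes "q \<ge> 2"
  shows "(\<forall>w F. QACC w F \<longrightarrow> (\<exists>w' G. QACCq q w' G \<and> qac0_reducible w F w' G)) \<and>
         (\<forall>w F. QACCq q w F \<longrightarrow> (\<exists>w' G. QACC w' G \<and> qac0_reducible w F w' G))"
proof (intro conjI allI impI)
  fix w F assume "QACC w F"
  then obtain p where "p \<ge> 2" "QACCq p w F" by (auto simp: QACC_def)
  then show "\<exists>w' G. QACCq q w' G \<and> qac0_reducible w F w' G" using QACCq_simulation assms by blast
next
  fix w F assume "QACCq q w F"
  then have "QACC w F" using assms by (auto simp: QACC_def)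
  moreover have "qac0_reducible w F w F"
    by (rule qac0_reducible_if_extends[where k = "\<lambda>_. 0" and z = "\<lambda>_. []"])
      (auto simp: states_def intro: poly_bounded_const)
  ultimately show "\<exists>w' G. QACC w' G \<and> qac0_reducible w F w' G" by blast
qed

end
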